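(* Let $1\le p<q<\infty$. There is a constant $C>0$ depending only on $p$ and $q$ such that the following holds for all $m\in\mathbb{N}$ with $m\ge16$. (i) For all $\varepsilon$ with $\left(\frac{16}{m}\right)^{\frac1p-\frac1q}\le\varepsilon<1$, $$n^{\mathrm{ran}}(\varepsilon,\ell_p^m\hookrightarrow\ell_q^m)\le C\cdot\begin{cases}\varepsilon^{-1/\left(\frac1p-\frac1q\right)}\cdot\log\log\left(m\cdot\varepsilon^{1/\left(\frac1p-\frac1q\right)}\right)&\text{for }1\le p\le2,\\ m^{1-\frac2p}\cdot\varepsilon^{-2/\left(1-\frac pq\right)}\cdot\log\log\left(m\cdot\varepsilon^{1/\left(\frac1p-\frac1q\right)}\right)&\text{for }p>2.\end{cases}$$ (ii) For all $n\in\mathbb{N}$ with $m\ge16n$, $$e^{\mathrm{ran}}(n,\ell_p^m\hookrightarrow\ell_q^m)\le C\cdot\begin{cases}\min\left\{1,\left(\frac{\log\log\frac mn}{n}\right)^{\frac1p-\frac1q}\right\}&\text{for }1\le p\le2,\\ \min\left\{1,\left(\frac{m^{1-2/p}\cdot\log\log\frac mn}{n}\right)^{\frac12\left(1-\frac pq\right)}\right\}&\text{for }p>2.\end{cases}$$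
   Context: $\log$ is the natural logarithm. A randomized algorithm for the problem $\ell_p^m\hookrightarrow\ell_q^m$ is a family $A=(A^\omega)_{\omega\in\Omega}$ of maps $A^\omega:\mathbb{R}^m\to\mathbb{R}^m$ indexed by a probability space $(\Omega,\Sigma,\mathbb{P})$ (with $A(\mathbf{x}):\omega\mapsto A^\omega(\mathbf{x})$ a random variable for each $\mathbf{x}$), where the output is computed as follows: linear functionals $L_1,L_2,\dots$ on $\mathbb{R}^m$ are evaluated one after another, $y_i=L_i(\mathbf{x})$; the choice of $L_i$ and the decision to stop may depend on $\omega$ and on $y_1,\dots,y_{i-1}$ (adaptivity); after a finite number $k=k(\omega,\mathbf{x})$ of evaluations the output is $A^\omega(\mathbf{x})=\phi(y_1,\dots,y_k)$, where the map $\phi$ may depend on $\omega$. The cardinality is $\operatorname{card}A=\sup_{\omega,\mathbf{x}}k(\omega,\mathbf{x})$, and the error is $$e(A,\ell_p^m\hookrightarrow\ell_q^m)=\sup_{\|\mathbf{x}\|_p\le1}\mathbb{E}\,\|\mathbf{x}-A(\mathbf{x})\|_q.$$ Further, $e^{\mathrm{ran}}(n,\ell_p^m\hookrightarrow\ell_q^m)=\inf\{e(A,\ell_p^m\hookrightarrow\ell_q^m):\operatorname{card}A\le n\}$ and $n^{\mathrm{ran}}(\varepsilon,\ell_p^m\hookrightarrow\ell_q^m)=\inf\{\operatorname{card}A: e(A,\ell_p^m\hookrightarrow\ell_q^m)\le\varepsilon\}$, the infima being over randomized (possibly adaptive) algorithms. *)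

theory Defs
  imports "HOL-Probability.Probability"
begin

section \<open>The spaces \<open>\<ell>\<^sub>p\<^sup>m\<close>\<close>

text \<open>
  The dimension \<open>m\<close> is quantified inside the theorem, after the constant, so it cannot be a type.
  \<open>\<real>\<^sup>m\<close> is the set of real sequences that vanish from index \<open>m\<close> on.
  The Borel sets of \<^typ>\<open>nat \<Rightarrow> real\<close> (product topology) induce the usual ones of \<open>\<real>\<^sup>m\<close>.
\<close>

type_synonym vec = "nat \<Rightarrow> real"

definition Rn :: "nat \<Rightarrow> vec set" where
  "Rn m = {x. \<forall>i\<ge>m. x i = 0}"

definition pnorm :: "nat \<Rightarrow> real \<Rightarrow> vec \<Rightarrow> real" where
  "pnorm m p x = (\<Sum>i<m. \<bar>x i\<bar> powr p) powr (1 / p)"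

definition linear_functional :: "nat \<Rightarrow> (vec \<Rightarrow> real) \<Rightarrow> bool" where
  "linear_functional m L \<longleftrightarrow>
     (\<forall>x\<in>Rn m. \<forall>y\<in>Rn m. L (\<lambda>i. x i + y i) = L x + L y) \<and>
     (\<forall>c. \<forall>x\<in>Rn m. L (\<lambda>i. c * x i) = c * L x)"


section \<open>Deterministic adaptive algorithms\<close>

text \<open>
  The real lists are the values \<open>[y\<^sub>1, \<dots>, y\<^sub>i]\<close> observed so far: \<open>query\<close> chooses the next
  functional, \<open>halts\<close> decides whether to stop, and \<open>recon\<close> is the map \<open>\<phi>\<close>.
\<close>

datatype det_alg = Det_Alg
  (query: "real list \<Rightarrow> vec \<Rightarrow> real")
  (halts: "real list \<Rightarrow> bool")
  (recon: "real list \<Rightarrow> vec")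

primrec info :: "det_alg \<Rightarrow> vec \<Rightarrow> nat \<Rightarrow> real list" where
  "info d x 0 = []"
| "info d x (Suc i) = info d x i @ [query d (info d x i) x]"

definition num_evals :: "det_alg \<Rightarrow> vec \<Rightarrow> nat" where
  "num_evals d x = (LEAST k. halts d (info d x k))"

definition alg_out :: "det_alg \<Rightarrow> vec \<Rightarrow> vec" where
  "alg_out d x = recon d (info d x (num_evals d x))"

definition valid_alg :: "nat \<Rightarrow> det_alg \<Rightarrow> bool" where
  "valid_alg m d \<longleftrightarrow>
     (\<forall>ys. linear_functional m (query d ys)) \<and>
     (\<forall>ys. recon d ys \<in> Rn m) \<and>
     (\<forall>x\<in>Rn m. \<exists>k. halts d (info d x k))"


section \<open>Randomized algorithms\<close>

definition ran_alg :: "nat \<Rightarrow> 'w measure \<Rightarrow> ('w \<Rightarrow> det_alg) \<Rightarrow> bool" where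
  "ran_alg m M A \<longleftrightarrow>
     prob_space M \<and>
     (\<forall>\<omega>\<in>space M. valid_alg m (A \<omega>)) \<and>
     (\<forall>x\<in>Rn m. (\<lambda>\<omega>. alg_out (A \<omega>) x) \<in> borel_measurable M)"

definition ran_card :: "nat \<Rightarrow> 'w measure \<Rightarrow> ('w \<Rightarrow> det_alg) \<Rightarrow> enat" where
  "ran_card m M A = (SUP \<omega>\<in>space M. SUP x\<in>Rn m. enat (num_evals (A \<omega>) x))"

definition ran_err ::
  "real \<Rightarrow> real \<Rightarrow> nat \<Rightarrow> 'w measure \<Rightarrow> ('w \<Rightarrow> det_alg) \<Rightarrow> ennreal" where
  "ran_err p q m M A =
     (SUP x\<in>{x \<in> Rn m. pnorm m p x \<le> 1}.
        \<integral>\<^sup>+\<omega>. ennreal (pnorm m q (\<lambda>i. x i - alg_out (A \<omega>) x i)) \<partial>M)"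

text \<open>
  A set of all probability spaces over all types is not available, so the infima below range over
  probability spaces whose points have type \<^typ>\<open>det_alg\<close>. This is no restriction: an
  algorithm \<open>(A\<^sup>\<omega>)\<close> over any probability space can be pushed forward along \<open>\<omega> \<mapsto> A\<^sup>\<omega>\<close> without
  changing its cardinality or its error. See \<open>e_ran_le\<close> and \<open>n_ran_le\<close>.
\<close>

definition e_ran :: "nat \<Rightarrow> real \<Rightarrow> real \<Rightarrow> nat \<Rightarrow> ennreal" where
  "e_ran n p q m =
     Inf {ran_err p q m M A | (M :: det_alg measure) (A :: det_alg \<Rightarrow> det_alg).
            ran_alg m M A \<and> ran_card m M A \<le> enat n}"

definition n_ran :: "real \<Rightarrow> real \<Rightarrow> real \<Rightarrow> nat \<Rightarrow> enat" where
  "n_ran \<epsilon> p q m =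
     Inf {ran_card m M A | (M :: det_alg measure) (A :: det_alg \<Rightarrow> det_alg).
            ran_alg m M A \<and> ran_err p q m M A \<le> ennreal \<epsilon>}"


section \<open>Independence of the sample space\<close>

lemma borel_measurable_pnorm_diff:
  assumes "f \<in> borel_measurable M"
  shows "(\<lambda>\<omega>. ennreal (pnorm m q (\<lambda>i. x i - f \<omega> i))) \<in> borel_measurable M"
proof -
  have [measurable]: "(\<lambda>\<omega>. f \<omega> i) \<in> borel_measurable M" for i
    by (rule measurable_product_then_coordinatewise[OF assms])
  show ?thesis unfolding pnorm_def by measurable
qed

lemma ran_alg_canonical:
  fixes M :: "'w measure"
  assumes A: "ran_alg m M A"
  obtains N :: "det_alg measure" where "ran_alg m N id"
    "ran_card m N id = ran_card m M A" "\<And>p q. ran_err p q m N id = ran_err p q m M A"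
proof -
  interpret prob_space M using A by (simp add: ran_alg_def)
  define S where "S = {B. B \<subseteq> A ` space M \<and> A -` B \<inter> space M \<in> sets M}"
  define G where "G = sigma (A ` space M) S"
  define N where "N = distr M G A"
  have S: "S \<subseteq> Pow (A ` space M)" by (auto simp: S_def)
  have A_meas: "A \<in> measurable M G"
    unfolding G_def by (rule measurable_measure_of) (use S in \<open>auto simp: S_def\<close>)
  have spN: "space N = A ` space M"
    unfolding N_def G_def using S by simp
  have out: "(\<lambda>d. alg_out d x) \<in> borel_measurable G" if "x \<in> Rn m" for x
  proof (rule measurableI)
    fix B :: "vec set" assume B: "B \<in> sets borel"
    have m: "(\<lambda>\<omega>. alg_out (A \<omega>) x) \<in> borel_measurable M"
      using A that by (simp add: ran_alg_def)
    have "A -` ((\<lambda>d. alg_out d x) -` B \<inter> A ` space M) \<inter> space M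
          = (\<lambda>\<omega>. alg_out (A \<omega>) x) -` B \<inter> space M" by auto
    with measurable_sets[OF m B]
    have "(\<lambda>d. alg_out d x) -` B \<inter> A ` space M \<in> S" by (auto simp: S_def)
    then show "(\<lambda>d. alg_out d x) -` B \<inter> space G \<in> sets G"
      using S by (simp add: G_def)
  qed simp
  have "ran_alg m N id"
    using A out prob_space_distr[OF A_meas] spN by (auto simp: ran_alg_def N_def)
  moreover have "ran_card m N id = ran_card m M A"
    by (simp add: ran_card_def spN image_image)
  moreover have "ran_err p q m N id = ran_err p q m M A" for p q
    unfolding ran_err_def N_def
    by (intro SUP_cong refl, subst nn_integral_distr)
       (auto intro!: A_meas borel_measurable_pnorm_diff out)
  ultimately show thesis by (rule that)
qed

lemma e_ran_le:
  fixes M :: "'w measure"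
  assumes "ran_alg m M A" "ran_card m M A \<le> enat n"
  shows "e_ran n p q m \<le> ran_err p q m M A"
proof -
  obtain N :: "det_alg measure" where "ran_alg m N id"
    "ran_card m N id = ran_card m M A" "\<And>p q. ran_err p q m N id = ran_err p q m M A"
    by (rule ran_alg_canonical[OF assms(1)]) (rule that)
  with assms(2) show ?thesis
    unfolding e_ran_def by (intro Inf_lower CollectI exI[of _ N] exI[of _ id]) simp
qed

lemma n_ran_le:
  fixes M :: "'w measure"
  assumes "ran_alg m M A" "ran_err p q m M A \<le> ennreal \<epsilon>"
  shows "n_ran \<epsilon> p q m \<le> ran_card m M A"
proof -
  obtain N :: "det_alg measure" where "ran_alg m N id"
    "ran_card m N id = ran_card m M A" "\<And>p q. ran_err p q m N id = ran_err p q m M A"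
    by (rule ran_alg_canonical[OF assms(1)]) (rule that)
  with assms(2) show ?thesis
    unfolding n_ran_def by (intro Inf_lower CollectI exI[of _ N] exI[of _ id]) simp
qed

end

theory Submission
  imports Defs
begin

text \<open>
  Both upper bounds come from one adaptive algorithm that searches for the large coordinates of
  \<open>x\<close>, reads them off exactly, and outputs \<open>0\<close> everywhere else. So a coordinate contributes
  to the error only if it is missed, and then by its full size.

  In one round the indices are hashed into \<open>B\<close> buckets, and in each bucket one dominant coordinate
  \<open>i\<close> is sought. Give every index \<open>j\<close> a random label \<open>a\<^sub>j\<close> and a random sign \<open>e\<^sub>j\<close> and measure
  \<open>\<Sum> e\<^sub>j x\<^sub>j\<close> and \<open>\<Sum> e\<^sub>j a\<^sub>j x\<^sub>j\<close> over the bucket. If the rest of the bucket is small, the quotient of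
  the two values rounds to \<open>a\<^sub>i\<close>. Adaptivity enters now: the next pair of measurements is
  restricted to the indices that share this label, which divides the noise energy by the number \<open>A\<close>
  of labels. The less noise is left, the more labels the next level can afford; the failure
  probability of a level is of order \<open>A\<^sup>2\<close> times the noise energy relative to \<open>x\<^sub>i\<^sup>2\<close>. Hence \<open>A\<close> may
  grow like a fixed power of the reduction \<open>P\<close> achieved so far, \<open>P\<close> grows doubly exponentially, and
  after \<open>O(log log s)\<close> levels, where \<open>s\<close> is about the bucket size \<open>m/B\<close>, the noise is low
  enough for a final label that is injective on the bucket and identifies \<open>i\<close>. One more
  measurement then returns \<open>x\<^sub>i\<close> exactly, so that no wrong value is ever output. The failure
  probabilities of the levels sum up to a constant times the relative noise energy at the
  start (\<open>card_missed_given_shift\<close>).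

  With \<open>r = min p 2\<close> and \<open>\<mu>\<close> a bound for \<open>\<Sum> \<bar>x\<^sub>j\<bar>\<^sup>r\<close> on the unit ball of \<open>\<ell>\<^sub>p\<^sup>m\<close>
  (\<open>\<mu> = 1\<close> for \<open>p \<le> 2\<close> and \<open>\<mu> = m\<^bsup>1-2/p\<^esup>\<close> for \<open>p > 2\<close>), averaging over the hash function shows
  that a round misses \<open>i\<close> with probability at most a constant times \<open>(\<mu>/B) / \<bar>x\<^sub>i\<bar>\<^sup>r\<close>
  (\<open>card_missed\<close>). Taking \<open>R \<ge> (q-p)/r\<close> independent rounds makes the expected \<open>q\<close>-th power of the
  error at most a constant times \<open>\<Sum> \<bar>x\<^sub>i\<bar>\<^sup>q ((\<mu>/B) / \<bar>x\<^sub>i\<bar>\<^sup>r)\<^bsup>(q-p)/r\<^esup> = (\<mu>/B)\<^bsup>(q-p)/r\<^esup> \<Sum> \<bar>x\<^sub>i\<bar>\<^sup>p\<close>, and thus the expected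
  error at most a constant times \<open>(\<mu>/B)\<^bsup>(1-p/q)/r\<^esup>\<close> (\<open>average_error\<close>). The cost is
  \<open>O(B log log (m/B))\<close>. Both parts of the theorem follow by choosing \<open>B\<close>: as small as the
  required accuracy allows, or as large as the budget \<open>n\<close> allows.

  All randomness is a uniform choice from a finite set, so that probabilities are quotients of
  cardinalities.
\<close>

section \<open>Resampling one coordinate of a uniform random function\<close>

text \<open>
  Replacing the value at \<open>j\<close> by a fresh one preserves the uniform distribution: exchanging
  \<open>(c, v)\<close> with \<open>(c(j := v), c j)\<close> is an involution. This is the only form of independence that
  the coordinates of the random functions below have to provide.
\<close>
lemma sum_resample:
  fixes f :: "('a \<Rightarrow> 'b) \<Rightarrow> real"
  assumes "j \<in> I"
  shows "(\<Sum>c\<in>I \<rightarrow>\<^sub>E S. \<Sum>v\<in>S. f (c(j := v))) = real (card S) * (\<Sum>c\<in>I \<rightarrow>\<^sub>E S. f c)"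
proof -
  have "(\<Sum>c\<in>I \<rightarrow>\<^sub>E S. \<Sum>v\<in>S. f (c(j := v))) = (\<Sum>(c, v)\<in>(I \<rightarrow>\<^sub>E S) \<times> S. f (c(j := v)))"
    by (rule sum.cartesian_product)
  also have "\<dots> = (\<Sum>(c, v)\<in>(I \<rightarrow>\<^sub>E S) \<times> S. f c)"
    by (rule sum.reindex_bij_witness[where i = "\<lambda>(c, v). (c(j := v), c j)"
          and j = "\<lambda>(c, v). (c(j := v), c j)"])
       (use assms in \<open>auto simp: PiE_iff extensional_def\<close>)
  also have "\<dots> = (\<Sum>c\<in>I \<rightarrow>\<^sub>E S. \<Sum>v\<in>S. f c)"
    by (rule sum.cartesian_product[symmetric])
  finally show ?thesis by (simp add: sum_distrib_left)
qed

lemma card_resample: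
  assumes "finite I" "finite S" "j \<in> I"
    and K: "\<And>c. c \<in> I \<rightarrow>\<^sub>E S \<Longrightarrow> card {v \<in> S. P (c(j := v))} \<le> K"
  shows "card S * card {c \<in> I \<rightarrow>\<^sub>E S. P c} \<le> K * card (I \<rightarrow>\<^sub>E S)"
proof -
  have fin: "finite (I \<rightarrow>\<^sub>E S)" using assms by (simp add: finite_PiE)
  have "real (card S * card {c \<in> I \<rightarrow>\<^sub>E S. P c}) = real (card S) * (\<Sum>c\<in>I \<rightarrow>\<^sub>E S. of_bool (P c))"
    using fin by (simp add: sum.If_cases of_bool_def Int_def)
  also have "\<dots> = (\<Sum>c\<in>I \<rightarrow>\<^sub>E S. \<Sum>v\<in>S. of_bool (P (c(j := v))))"
    by (rule sum_resample[symmetric]) fact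
  also have "\<dots> = (\<Sum>c\<in>I \<rightarrow>\<^sub>E S. real (card {v \<in> S. P (c(j := v))}))"
    using assms(2) by (simp add: sum.If_cases of_bool_def Int_def)
  also have "\<dots> \<le> (\<Sum>c\<in>I \<rightarrow>\<^sub>E S. real K)"
    by (intro sum_mono) (use K in simp)
  also have "\<dots> = real (K * card (I \<rightarrow>\<^sub>E S))" by simp
  finally show ?thesis by (simp only: of_nat_le_iff)
qed

text \<open>
  Distinct random signs are uncorrelated, so mixed terms cancel. Random signs are what makes the noise
  accumulate in \<open>\<ell>\<^sub>2\<close> rather than in \<open>\<ell>\<^sub>1\<close>.
\<close>
lemma sum_random_signs_squared:
  fixes w :: "'a \<Rightarrow> real"
  assumes "finite I" "J \<subseteq> I"
  shows "(\<Sum>e\<in>I \<rightarrow>\<^sub>E {-1, 1}. (\<Sum>j\<in>J. e j * w j)\<^sup>2)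
       = real (card (I \<rightarrow>\<^sub>E {-1, 1 :: real})) * (\<Sum>j\<in>J. (w j)\<^sup>2)"
proof -
  let ?E = "I \<rightarrow>\<^sub>E {-1, 1 :: real}"
  have "finite J" using assms finite_subset by blast
  have corr: "(\<Sum>e\<in>?E. e j * e k) = (if j = k then real (card ?E) else 0)" if "j \<in> J" "k \<in> J" for j k
  proof (cases "j = k")
    case True
    have "e j * e j = 1" if "e \<in> ?E" for e
    proof -
      have "e j \<in> {-1, 1}" using PiE_mem[OF that, of j] \<open>j \<in> J\<close> assms(2) by blast
      thus ?thesis by auto
    qed
    with True show ?thesis by simp
  next
    case False
    have "2 * (\<Sum>e\<in>?E. e j * e k) = (\<Sum>e\<in>?E. \<Sum>v\<in>{-1, 1}. (e(j := v)) j * (e(j := v)) k)"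
      by (subst sum_resample) (use that assms(2) in auto)
    also have "\<dots> = 0" using False by simp
    finally show ?thesis using False by simp
  qed
  have "(\<Sum>e\<in>?E. (\<Sum>j\<in>J. e j * w j)\<^sup>2) = (\<Sum>e\<in>?E. \<Sum>j\<in>J. \<Sum>k\<in>J. w j * w k * (e j * e k))"
    by (simp add: power2_eq_square sum_product algebra_simps)
  also have "\<dots> = (\<Sum>j\<in>J. \<Sum>k\<in>J. w j * w k * (\<Sum>e\<in>?E. e j * e k))"
    by (subst sum.swap, rule sum.cong[OF refl], subst sum.swap) (simp add: sum_distrib_left)
  also have "\<dots> = (\<Sum>j\<in>J. \<Sum>k\<in>J. if j = k then w j * w k * real (card ?E) else 0)"
    by (intro sum.cong refl) (simp add: corr)
  also have "\<dots> = (\<Sum>j\<in>J. (w j)\<^sup>2 * real (card ?E))"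
    using \<open>finite J\<close> by (simp add: power2_eq_square)
  finally show ?thesis by (simp add: sum_distrib_right[symmetric] mult.commute)
qed

section \<open>The schedule of label sizes\<close>

text \<open>
  The labels of an index are consecutive blocks of the binary digits of a random code number, and
  \<open>bits_read l\<close> digits are used up before level \<open>l\<close>. With \<open>P = 2 ^ bits_read l\<close>, level \<open>l\<close> has
  about \<open>4 * P powr (1/4)\<close> labels. An exponent below \<open>1/2\<close> makes the ratio \<open>A\<^sup>2 / P\<close> summable
  over the levels; the summand \<open>2\<close> gets the growth started.
\<close>
primrec bits_read :: "nat \<Rightarrow> nat" where
  "bits_read 0 = 0"
| "bits_read (Suc l) = bits_read l + bits_read l div 4 + 2"

lemma bits_read_ge_double: "2 * l \<le> bits_read l"
  by (induction l) auto

text \<open>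
  In terms of the number \<open>A\<close> of labels and the noise reduction \<open>P\<close>, this is \<open>A\<^sup>2 / P \<le> 16 / 2 ^ l\<close>.
\<close>
lemma bits_read_Suc_diff: "2 * (bits_read (Suc l) - bits_read l) + l \<le> bits_read l + 4"
  using bits_read_ge_double[of l] by simp

lemma bits_read_ge_power: "4 * (5/4) ^ l \<le> real (bits_read l) + 4"
proof (induction l)
  case (Suc l)
  have "bits_read l \<le> 4 * (bits_read l div 4) + 3" by presburger
  hence "real (bits_read l) \<le> 4 * real (bits_read l div 4) + 3" by linarith
  thus ?case using Suc by simp
qed simp

lemma bits_read_mono: "k \<le> l \<Longrightarrow> bits_read k \<le> bits_read l"
  by (induction rule: dec_induct) auto

text \<open>
  The number of bits grows geometrically, so \<open>2 ^ bits_read T\<close> grows doubly exponentially. The final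
  labels take up to \<open>s\<close> values, and the noise reduction \<open>s\<^sup>2\<close> makes their failure probability
  comparable to that of the first level.
\<close>
lemma exists_level_count:
  fixes z :: real
  assumes z: "z \<ge> 16" and s: "real s \<le> z + 1"
  shows "\<exists>T. s\<^sup>2 \<le> 2 ^ bits_read T \<and> real T \<le> 5 * ln (ln z) + 11"
proof -
  define T where "T = nat \<lceil>5 * (2 + ln (ln z))\<rceil>"
  have e3: "exp 1 \<le> (3::real)" by (rule exp_le)
  have lnz: "ln z \<ge> 1" using z e3 by (subst ln_ge_iff) auto
  hence lnln: "ln (ln z) \<ge> 0" by simp
  have T1: "real T \<ge> 5 * (2 + ln (ln z))" unfolding T_def by linarith
  have T2: "real T \<le> 5 * ln (ln z) + 11"
    unfolding T_def using lnln of_int_ceiling_le_add_one[of "5 * (2 + ln (ln z))"] by simp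
  have "ln (5/4::real) = - ln (4/5)" by (simp add: ln_div)
  moreover have "ln (4/5::real) \<le> 4/5 - 1" by (rule ln_le_minus_one) simp
  ultimately have l54: "ln (5/4::real) \<ge> 1/5" by simp
  have "exp 2 * ln z = exp (2 + ln (ln z))" using lnz by (simp add: exp_add)
  also have "\<dots> \<le> exp (real T * ln (5/4))"
  proof -
    have "real T * (1/5) \<le> real T * ln (5/4)" by (intro mult_left_mono l54) simp
    thus ?thesis using T1 by simp
  qed
  also have "\<dots> = (5/4) ^ T" by (simp add: exp_of_nat_mult)
  finally have pT: "exp 2 * ln z \<le> (5/4) ^ T" .
  have "exp 2 = exp 1 * exp (1::real)" by (simp flip: exp_add)
  moreover have "exp 1 \<ge> (2::real)" using exp_ge_add_one_self[of 1] by simp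
  ultimately have "exp 2 \<ge> (4::real)" using mult_mono[of 2 "exp 1" 2 "exp (1::real)"] by simp
  hence "4 * ln z \<le> exp 2 * ln z" using lnz by (intro mult_right_mono) auto
  hence E: "real (bits_read T) \<ge> 12 * ln z"
    using pT bits_read_ge_power[of T] lnz by linarith
  have "ln (2::real) \<ge> 1/2"
  proof -
    have "ln (1/2::real) \<le> 1/2 - 1" by (rule ln_le_minus_one) simp
    thus ?thesis by (simp add: ln_div)
  qed
  hence "real (bits_read T) * (1/2) \<le> real (bits_read T) * ln 2" by (intro mult_left_mono) auto
  hence E2: "4 * ln z \<le> real (bits_read T) * ln 2" using E lnz by linarith
  have "real s \<le> z * z" using s z mult_mono[of 2 z z z] by linarith
  hence "(real s)\<^sup>2 \<le> (z * z)\<^sup>2" by (intro power_mono) auto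
  also have "\<dots> = exp (4 * ln z)"
    using z by (simp add: exp_of_nat_mult[of 4, simplified] power2_eq_square power4_eq_xxxx)
  also have "\<dots> \<le> exp (real (bits_read T) * ln 2)" using E2 by simp
  also have "\<dots> = 2 ^ bits_read T" by (simp add: exp_of_nat_mult)
  finally have "real (s\<^sup>2) \<le> real (2 ^ bits_read T)" by simp
  hence "s\<^sup>2 \<le> 2 ^ bits_read T" by (simp only: of_nat_le_iff)
  with T2 show ?thesis by blast
qed

section \<open>Random buckets, labels and signs\<close>

lemma mod_add_cancel_nat: "(a + c) mod n = (b + c) mod n \<Longrightarrow> a mod n = b mod n" for a b c n :: nat
proof -
  assume "(a + c) mod n = (b + c) mod n"
  then obtain k l where "a + c + n * k = b + c + n * l" unfolding nat_mod_eq_iff by blast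
  hence "a + n * k = b + n * l" by linarith
  thus ?thesis unfolding nat_mod_eq_iff by blast
qed

text \<open>
  The randomness of one round: a shift for each row of the bucket grid, a code number for each index,
  and a sign for each index.
\<close>

type_synonym seed = "(nat \<Rightarrow> nat) \<times> (nat \<Rightarrow> nat) \<times> (nat \<Rightarrow> real)"

locale bucket_coding =
  fixes m B T :: nat
  assumes B_pos: "0 < B"
    and T_large: "(m div B + 1)\<^sup>2 \<le> 2 ^ bits_read T"
begin

text \<open>
  The indices are written into rows of length \<open>B\<close>, and each row is rotated by its own random shift.
  Compared with a fully random hash function this keeps every bucket small (at most one index from
  each row) and makes the row number an injective label inside a bucket, while two indices still
  collide with probability at most \<open>1/B\<close>.
\<close>
definition bucket :: "(nat \<Rightarrow> nat) \<Rightarrow> nat \<Rightarrow> nat" where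
  "bucket \<sigma> j = (j + \<sigma> (j div B)) mod B"

text \<open>
  The levels below \<open>T\<close> use random digits of the code; the last level uses the row number.
\<close>
definition label :: "(nat \<Rightarrow> nat) \<Rightarrow> nat \<Rightarrow> nat \<Rightarrow> nat" where
  "label c l j = (if l < T then c j mod 2 ^ bits_read (Suc l) div 2 ^ bits_read l else j div B)"

definition spread :: "nat \<Rightarrow> nat" where
  "spread l = (if l < T then 2 ^ (bits_read (Suc l) - bits_read l) else m div B + 1)"

definition shifts :: "(nat \<Rightarrow> nat) set" where
  "shifts = {..<m div B + 1} \<rightarrow>\<^sub>E {..<B}"

definition codes :: "(nat \<Rightarrow> nat) set" where
  "codes = {..<m} \<rightarrow>\<^sub>E {..<2 ^ bits_read T}"

definition signs :: "(nat \<Rightarrow> real) set" where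
  "signs = {..<m} \<rightarrow>\<^sub>E {-1, 1}"

definition mates :: "(nat \<Rightarrow> nat) \<Rightarrow> nat \<Rightarrow> nat set" where
  "mates \<sigma> i = {j. j < m \<and> j \<noteq> i \<and> bucket \<sigma> j = bucket \<sigma> i}"

text \<open>
  If all labels of \<open>i\<close> below level \<open>l\<close> were decoded correctly, the indices still considered
  together with \<open>i\<close> at level \<open>l\<close> are exactly its rivals. They depend on \<open>i\<close> and the seed but not on
  \<open>x\<close>, so that the adaptive search can be analysed level by level without conditioning.
\<close>
definition rivals :: "(nat \<Rightarrow> nat) \<Rightarrow> (nat \<Rightarrow> nat) \<Rightarrow> nat \<Rightarrow> nat \<Rightarrow> nat set" where
  "rivals \<sigma> c i l = {j \<in> mates \<sigma> i. \<forall>k<l. label c k j = label c k i}"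

text \<open>
  The two sums are the noise in the two measurements of level \<open>l\<close>. If both are below
  \<open>\<bar>x i\<bar> / 4\<close>, then the quotient of the measurements is within \<open>1/3\<close> of the label
  of \<open>i\<close>; so an index that is not missed in this sense is located.
\<close>
definition missed ::
  "vec \<Rightarrow> nat \<Rightarrow> seed \<Rightarrow> bool" where
  "missed x i = (\<lambda>(\<sigma>, c, e). \<exists>l\<le>T.
     \<bar>x i\<bar> \<le> 4 * \<bar>\<Sum>j\<in>rivals \<sigma> c i l. e j * x j\<bar> \<or>
     \<bar>x i\<bar> \<le> 4 * \<bar>\<Sum>j\<in>rivals \<sigma> c i l. e j * ((real (label c l j) - real (label c l i)) * x j)\<bar>)"

lemma finite_samples: "finite shifts" "finite codes" "finite signs"
  by (auto simp: shifts_def codes_def signs_def intro!: finite_PiE)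

lemma samples_nonempty: "shifts \<noteq> {}" "codes \<noteq> {}" "signs \<noteq> {}"
  using B_pos by (auto simp: shifts_def codes_def signs_def PiE_eq_empty_iff lessThan_empty_iff)

lemma finite_mates [simp]: "finite (mates \<sigma> i)"
  by (simp add: mates_def)

lemma finite_rivals [simp]: "finite (rivals \<sigma> c i l)"
  by (simp add: rivals_def)

lemma bucket_less: "bucket \<sigma> j < B"
  using B_pos by (simp add: bucket_def)

lemma bucket_inj:
  assumes "bucket \<sigma> i = bucket \<sigma> j" "i div B = j div B"
  shows "i = j"
proof -
  have "(i + \<sigma> (i div B)) mod B = (j + \<sigma> (i div B)) mod B"
    using assms(1) unfolding bucket_def assms(2) .
  hence "i mod B = j mod B" by (rule mod_add_cancel_nat)
  thus ?thesis using assms(2) by (metis div_mod_decomp)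
qed

lemma label_less_spread:
  assumes "j < m"
  shows "label c l j < spread l"
proof (cases "l < T")
  case True
  have "c j mod 2 ^ bits_read (Suc l) < 2 ^ bits_read (Suc l)" by simp
  also have "\<dots> = 2 ^ (bits_read (Suc l) - bits_read l) * (2::nat) ^ bits_read l"
    by (simp flip: power_add)
  finally have "c j mod 2 ^ bits_read (Suc l) div 2 ^ bits_read l < 2 ^ (bits_read (Suc l) - bits_read l)"
    by (rule less_mult_imp_div_less)
  thus ?thesis unfolding label_def spread_def using True by (simp del: bits_read.simps)
next
  case False
  have "j div B \<le> m div B" using assms by (intro div_le_mono) simp
  thus ?thesis using False by (simp add: label_def spread_def)
qed

lemma residues_agree:
  assumes "l \<le> T" "\<forall>k<l. label c k j = label c k i"
  shows "c j mod 2 ^ bits_read l = c i mod 2 ^ bits_read l"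
  using assms
proof (induction l)
  case (Suc l)
  have split: "n mod 2 ^ bits_read (Suc l) = 2 ^ bits_read l * (n mod 2 ^ bits_read (Suc l) div 2 ^ bits_read l) + n mod 2 ^ bits_read l"
    for n :: nat
  proof -
    have "(2::nat) ^ bits_read l dvd 2 ^ bits_read (Suc l)" by (intro le_imp_power_dvd) simp
    hence "n mod 2 ^ bits_read (Suc l) mod 2 ^ bits_read l = n mod 2 ^ bits_read l" by (rule mod_mod_cancel)
    thus ?thesis using mult_div_mod_eq[of "2 ^ bits_read l" "n mod 2 ^ bits_read (Suc l)"] by metis
  qed
  have "label c l j = label c l i" using Suc.prems by blast
  hence "c j mod 2 ^ bits_read (Suc l) div 2 ^ bits_read l = c i mod 2 ^ bits_read (Suc l) div 2 ^ bits_read l"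
    using Suc.prems(1) by (simp add: label_def del: bits_read.simps)
  moreover have "c j mod 2 ^ bits_read l = c i mod 2 ^ bits_read l" using Suc by simp
  ultimately show ?case by (subst (1 2) split) (simp only:)
qed simp

lemma rivals_empty: "rivals \<sigma> c i (Suc T) = {}"
proof -
  have False if "j \<in> rivals \<sigma> c i (Suc T)" for j
  proof -
    have "label c T j = label c T i" using that by (auto simp: rivals_def)
    hence "j div B = i div B" by (simp add: label_def)
    thus False using that bucket_inj[of \<sigma> j i] by (auto simp: rivals_def mates_def)
  qed
  thus ?thesis by blast
qed

text \<open>
  Level \<open>l\<close> is reached by a given rival with probability \<open>1 / 2 ^ bits_read l\<close>: resample its code.
\<close>
lemma card_agreeing_codes:
  assumes "i < m" "j < m" "j \<noteq> i" "l \<le> T"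
  shows "2 ^ bits_read l * card {c \<in> codes. c j mod 2 ^ bits_read l = c i mod 2 ^ bits_read l} \<le> card codes"
proof -
  let ?P = "2 ^ bits_read l :: nat" and ?K = "2 ^ (bits_read T - bits_read l) :: nat"
  have Q: "2 ^ bits_read T = ?K * ?P"
    using bits_read_mono[OF assms(4)] by (simp flip: power_add)
  have "2 ^ bits_read T * card {c \<in> codes. c j mod ?P = c i mod ?P} \<le> ?K * card codes"
  proof -
    have "card {v \<in> {..<2 ^ bits_read T}. (c(j := v)) j mod ?P = (c(j := v)) i mod ?P} \<le> ?K" for c
    proof -
      have "{v \<in> {..<2 ^ bits_read T}. v mod ?P = c i mod ?P} \<subseteq> (\<lambda>k. ?P * k + c i mod ?P) ` {..<?K}"
      proof
        fix v assume v: "v \<in> {v \<in> {..<2 ^ bits_read T}. v mod ?P = c i mod ?P}"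
        hence "v < ?K * ?P" using Q by simp
        hence "v div ?P < ?K" by (rule less_mult_imp_div_less)
        moreover have "v = ?P * (v div ?P) + c i mod ?P"
          using v mult_div_mod_eq[of ?P v] by simp
        ultimately show "v \<in> (\<lambda>k. ?P * k + c i mod ?P) ` {..<?K}" by blast
      qed
      hence "card {v \<in> {..<2 ^ bits_read T}. v mod ?P = c i mod ?P} \<le> card {..<?K}"
        by (meson card_image_le card_mono finite_imageI finite_lessThan le_trans)
      thus ?thesis using assms(3) by simp
    qed
    from card_resample[of "{..<m}" "{..<2 ^ bits_read T}" j "\<lambda>c. c j mod ?P = c i mod ?P" ?K, OF _ _ _ this]
    show ?thesis using assms(2) by (simp add: codes_def)
  qed
  hence "?K * (?P * card {c \<in> codes. c j mod ?P = c i mod ?P}) \<le> ?K * card codes"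
    unfolding Q by (simp only: mult.assoc)
  thus ?thesis by simp
qed

text \<open>
  Indices in the same row never collide. Otherwise resample the shift of the row of \<open>j\<close>:
  at most one value sends \<open>j\<close> to the bucket of \<open>i\<close>.
\<close>
lemma card_colliding_shifts:
  assumes "i < m" "j < m" "j \<noteq> i"
  shows "B * card {\<sigma> \<in> shifts. bucket \<sigma> j = bucket \<sigma> i} \<le> card shifts"
proof (cases "j div B = i div B")
  case True
  hence "{\<sigma> \<in> shifts. bucket \<sigma> j = bucket \<sigma> i} = {}" using assms(3) bucket_inj by blast
  thus ?thesis by (simp only: card.empty mult_0_right le0)
next
  case False
  have one: "card {v \<in> {..<B}. bucket (\<sigma>(j div B := v)) j = bucket (\<sigma>(j div B := v)) i} \<le> 1" for \<sigma>
  proof -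
    let ?V = "{v \<in> {..<B}. (j + v) mod B = bucket \<sigma> i}"
    have uniq: "v = w" if "v \<in> ?V" "w \<in> ?V" for v w
    proof -
      have "(v + j) mod B = (w + j) mod B" using that by (simp add: add.commute[of _ j])
      hence "v mod B = w mod B" by (rule mod_add_cancel_nat)
      moreover have "v < B" "w < B" using that by auto
      ultimately show ?thesis using mod_less by metis
    qed
    have fin: "finite ?V" by simp
    have "card ?V \<le> 1"
      unfolding One_nat_def card_le_Suc0_iff_eq[OF fin] by (intro ballI uniq)
    moreover have "{v \<in> {..<B}. bucket (\<sigma>(j div B := v)) j = bucket (\<sigma>(j div B := v)) i} = ?V"
      using False by (simp add: bucket_def)
    ultimately show ?thesis by (simp only:)
  qed
  have "card {..<B} * card {\<sigma> \<in> shifts. bucket \<sigma> j = bucket \<sigma> i} \<le> 1 * card shifts"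
    unfolding shifts_def
  proof (rule card_resample[of _ _ "j div B"])
    show "j div B \<in> {..<m div B + 1}"
      using div_le_mono[of j m B] assms(2) by simp
  qed (simp, simp, rule one)
  thus ?thesis by simp
qed

lemma sum_spread_le: "(\<Sum>l\<le>T. (real (spread l))\<^sup>2 / 2 ^ bits_read l) \<le> 33"
proof -
  have geo: "(\<Sum>l<n. 16 * (1/2) ^ l) \<le> (32::real)" for n
  proof -
    have "(\<Sum>l<n. 16 * (1/2) ^ l) = 32 - 32 * (1/2 :: real) ^ n"
      by (induction n) (simp_all add: field_simps)
    thus ?thesis by simp
  qed
  have "(\<Sum>l<T. (real (spread l))\<^sup>2 / 2 ^ bits_read l) \<le> (\<Sum>l<T. 16 * (1/2) ^ l)"
  proof (rule sum_mono)
    fix l assume "l \<in> {..<T}"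
    hence "(real (spread l))\<^sup>2 = 2 ^ (2 * (bits_read (Suc l) - bits_read l))"
      by (simp add: spread_def mult.commute flip: power_mult)
    moreover have "(2::real) ^ (2 * (bits_read (Suc l) - bits_read l)) * 2 ^ l \<le> 2 ^ bits_read l * 16"
    proof -
      have "(2::real) ^ (2 * (bits_read (Suc l) - bits_read l) + l) \<le> 2 ^ (bits_read l + 4)"
        by (intro power_increasing bits_read_Suc_diff) simp
      thus ?thesis by (simp add: power_add)
    qed
    ultimately show "(real (spread l))\<^sup>2 / 2 ^ bits_read l \<le> 16 * (1/2) ^ l"
      by (simp add: field_simps power_one_over del: bits_read.simps)
  qed
  moreover have "(real (spread T))\<^sup>2 / 2 ^ bits_read T \<le> 1"
  proof -
    have "real ((m div B + 1)\<^sup>2) \<le> real (2 ^ bits_read T)" using T_large by (simp only: of_nat_le_iff)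
    thus ?thesis by (simp add: spread_def)
  qed
  moreover have "(\<Sum>l\<le>T. (real (spread l))\<^sup>2 / 2 ^ bits_read l)
     = (\<Sum>l<T. (real (spread l))\<^sup>2 / 2 ^ bits_read l) + (real (spread T))\<^sup>2 / 2 ^ bits_read T"
    by (simp flip: lessThan_Suc_atMost)
  ultimately show ?thesis using geo[of T] by linarith
qed

text \<open>
  The mean square over the signs of both noise terms of a level. The factor is \<open>1 + (A - 1)\<^sup>2 \<le> A\<^sup>2\<close>,
  as two labels differ by at most \<open>A - 1\<close>.
\<close>
lemma level_noise:
  assumes i: "i < m"
  shows "(\<Sum>e\<in>signs. (\<Sum>j\<in>rivals \<sigma> c i l. e j * x j)\<^sup>2
            + (\<Sum>j\<in>rivals \<sigma> c i l. e j * ((real (label c l j) - real (label c l i)) * x j))\<^sup>2)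
       \<le> real (card signs) * (real (spread l))\<^sup>2 * (\<Sum>j\<in>rivals \<sigma> c i l. (x j)\<^sup>2)"
proof -
  let ?H = "rivals \<sigma> c i l" and ?d = "\<lambda>j. real (label c l j) - real (label c l i)"
  have sub: "?H \<subseteq> {..<m}" by (auto simp: rivals_def mates_def)
  have "1 + (?d j)\<^sup>2 \<le> (real (spread l))\<^sup>2" if "j \<in> ?H" for j
  proof -
    have j: "j < m" using that sub by auto
    have a: "\<bar>?d j\<bar> \<le> real (spread l) - 1" and b: "real (spread l) \<ge> 1"
      using label_less_spread[OF i, of c l] label_less_spread[OF j, of c l] by linarith+
    have "(?d j)\<^sup>2 \<le> (real (spread l) - 1)\<^sup>2" using a by (rule power2_le_iff_abs_le[THEN iffD2, rotated]) (use b in simp)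
    thus ?thesis using b by (simp add: power2_eq_square algebra_simps)
  qed
  hence "(\<Sum>j\<in>?H. (1 + (?d j)\<^sup>2) * (x j)\<^sup>2) \<le> (\<Sum>j\<in>?H. (real (spread l))\<^sup>2 * (x j)\<^sup>2)"
    by (intro sum_mono mult_right_mono) auto
  hence "real (card signs) * (\<Sum>j\<in>?H. (1 + (?d j)\<^sup>2) * (x j)\<^sup>2)
     \<le> real (card signs) * (\<Sum>j\<in>?H. (real (spread l))\<^sup>2 * (x j)\<^sup>2)"
    by (intro mult_left_mono) auto
  moreover have "(\<Sum>e\<in>signs. (\<Sum>j\<in>?H. e j * x j)\<^sup>2 + (\<Sum>j\<in>?H. e j * (?d j * x j))\<^sup>2)
      = real (card signs) * (\<Sum>j\<in>?H. (1 + (?d j)\<^sup>2) * (x j)\<^sup>2)"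
    unfolding signs_def sum.distrib
      sum_random_signs_squared[OF finite_lessThan sub, of x]
      sum_random_signs_squared[OF finite_lessThan sub, of "\<lambda>j. ?d j * x j"]
    by (simp add: sum.distrib distrib_left distrib_right power_mult_distrib)
  ultimately show ?thesis by (simp add: sum_distrib_left mult.assoc)
qed

text \<open>
  For fixed buckets, Chebyshev's inequality bounds the failure probability of level \<open>l\<close> by
  \<open>16 * A\<^sup>2 / P\<close> times the initial noise energy relative to \<open>(x i)\<^sup>2\<close>, where \<open>P\<close> is the reduction
  of the noise energy by the labels already matched. The schedule makes these bounds summable
  to \<open>16 * 33 = 528\<close>.
\<close>
lemma card_missed_given_shift:
  assumes i: "i < m" and xi: "x i \<noteq> 0"
  shows "real (card {(c, e) \<in> codes \<times> signs. missed x i (\<sigma>, c, e)})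
       \<le> 528 * real (card codes) * real (card signs) * (\<Sum>j\<in>mates \<sigma> i. (x j / x i)\<^sup>2)"
proof -
  let ?W = "\<lambda>c e l. \<Sum>j\<in>rivals \<sigma> c i l. e j * x j"
  let ?V = "\<lambda>c e l. \<Sum>j\<in>rivals \<sigma> c i l. e j * ((real (label c l j) - real (label c l i)) * x j)"
  let ?F = "\<lambda>c e l. 16 * ((?W c e l)\<^sup>2 + (?V c e l)\<^sup>2) / (x i)\<^sup>2"
  have pt: "of_bool (missed x i (\<sigma>, c, e)) \<le> (\<Sum>l\<le>T. ?F c e l)" for c e
  proof (cases "missed x i (\<sigma>, c, e)")
    case True
    then obtain l where l: "l \<le> T" "\<bar>x i\<bar> \<le> 4 * \<bar>?W c e l\<bar> \<or> \<bar>x i\<bar> \<le> 4 * \<bar>?V c e l\<bar>"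
      by (auto simp: missed_def)
    have sq: "(x i)\<^sup>2 \<le> 16 * y\<^sup>2" if "\<bar>x i\<bar> \<le> 4 * \<bar>y\<bar>" for y :: real
      using power_mono[OF that, of 2] by (simp add: power_mult_distrib)
    have "(x i)\<^sup>2 \<le> 16 * ((?W c e l)\<^sup>2 + (?V c e l)\<^sup>2)"
      using l(2) sq[of "?W c e l"] sq[of "?V c e l"] zero_le_power2[of "?W c e l"] zero_le_power2[of "?V c e l"]
      by argo
    hence "1 \<le> ?F c e l" using xi by (simp add: field_simps)
    also have "\<dots> \<le> (\<Sum>l\<le>T. ?F c e l)"
      by (rule member_le_sum[of l "{..T}" "?F c e"]) (use l in auto)
    finally show ?thesis using True by simp
  qed (auto intro!: sum_nonneg)
  have swap: "(\<Sum>c\<in>codes. \<Sum>e\<in>signs. \<Sum>l\<le>T. f c e l) = (\<Sum>l\<le>T. \<Sum>c\<in>codes. \<Sum>e\<in>signs. f c e l)"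
    for f :: "(nat \<Rightarrow> nat) \<Rightarrow> (nat \<Rightarrow> real) \<Rightarrow> nat \<Rightarrow> real"
  proof -
    have "(\<Sum>e\<in>signs. \<Sum>l\<le>T. f c e l) = (\<Sum>l\<le>T. \<Sum>e\<in>signs. f c e l)" for c
      by (rule sum.swap)
    thus ?thesis by (simp only:) (rule sum.swap)
  qed
  have "real (card {(c, e) \<in> codes \<times> signs. missed x i (\<sigma>, c, e)})
      = (\<Sum>(c, e)\<in>codes \<times> signs. of_bool (missed x i (\<sigma>, c, e)))"
    using finite_samples
    by (simp add: case_prod_unfold sum.If_cases of_bool_def Int_def)
       (rule arg_cong[where f = card], auto)
  also have "\<dots> = (\<Sum>c\<in>codes. \<Sum>e\<in>signs. of_bool (missed x i (\<sigma>, c, e)))"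
    by (rule sum.cartesian_product[symmetric])
  also have "\<dots> \<le> (\<Sum>c\<in>codes. \<Sum>e\<in>signs. \<Sum>l\<le>T. ?F c e l)"
    by (intro sum_mono pt)
  also have "\<dots> = (\<Sum>l\<le>T. \<Sum>c\<in>codes. \<Sum>e\<in>signs. ?F c e l)"
    by (rule swap)
  also have "\<dots> \<le> (\<Sum>l\<le>T. 16 * real (card codes) * real (card signs) * (\<Sum>j\<in>mates \<sigma> i. (x j / x i)\<^sup>2)
                   * ((real (spread l))\<^sup>2 / 2 ^ bits_read l))"
  proof (rule sum_mono)
    fix l assume "l \<in> {..T}"
    hence l: "l \<le> T" by simp
    have agree: "(\<Sum>c\<in>codes. of_bool (j \<in> rivals \<sigma> c i l)) \<le> real (card codes) / 2 ^ bits_read l"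
      if "j \<in> mates \<sigma> i" for j
    proof -
      have j: "j < m" "j \<noteq> i" using that by (auto simp: mates_def)
      have "(\<Sum>c\<in>codes. of_bool (j \<in> rivals \<sigma> c i l))
          \<le> (\<Sum>c\<in>codes. of_bool (c j mod 2 ^ bits_read l = c i mod 2 ^ bits_read l) :: real)"
        using residues_agree[OF l] by (intro sum_mono) (auto simp: rivals_def)
      also have "\<dots> = real (card {c \<in> codes. c j mod 2 ^ bits_read l = c i mod 2 ^ bits_read l})"
        using finite_samples by (simp add: sum.If_cases of_bool_def Int_def)
      also have "\<dots> \<le> real (card codes) / 2 ^ bits_read l"
      proof -
        have "real (2 ^ bits_read l * card {c \<in> codes. c j mod 2 ^ bits_read l = c i mod 2 ^ bits_read l}) \<le> real (card codes)"
          using card_agreeing_codes[OF i j l] by (simp only: of_nat_le_iff)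
        thus ?thesis by (simp add: field_simps)
      qed
      finally show ?thesis .
    qed
    have "(\<Sum>c\<in>codes. \<Sum>e\<in>signs. ?F c e l)
        = 16 / (x i)\<^sup>2 * (\<Sum>c\<in>codes. \<Sum>e\<in>signs. (?W c e l)\<^sup>2 + (?V c e l)\<^sup>2)"
      by (simp add: sum_distrib_left)
    also have "\<dots> \<le> 16 / (x i)\<^sup>2 * (\<Sum>c\<in>codes. real (card signs) * (real (spread l))\<^sup>2 * (\<Sum>j\<in>rivals \<sigma> c i l. (x j)\<^sup>2))"
      by (intro mult_left_mono sum_mono level_noise i) simp
    also have "\<dots> = 16 * real (card signs) * (real (spread l))\<^sup>2
        * (\<Sum>c\<in>codes. \<Sum>j\<in>mates \<sigma> i. of_bool (j \<in> rivals \<sigma> c i l) * (x j / x i)\<^sup>2)"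
    proof -
      have "(\<Sum>j\<in>rivals \<sigma> c i l. (x j)\<^sup>2) = (x i)\<^sup>2 * (\<Sum>j\<in>mates \<sigma> i. of_bool (j \<in> rivals \<sigma> c i l) * (x j / x i)\<^sup>2)" for c
      proof -
        have "(\<Sum>j\<in>rivals \<sigma> c i l. (x j)\<^sup>2) = (\<Sum>j\<in>mates \<sigma> i. if j \<in> rivals \<sigma> c i l then (x j)\<^sup>2 else 0)"
          by (rule sum.mono_neutral_cong_left) (auto simp: rivals_def)
        also have "\<dots> = (\<Sum>j\<in>mates \<sigma> i. (x i)\<^sup>2 * (of_bool (j \<in> rivals \<sigma> c i l) * (x j / x i)\<^sup>2))"
          using xi by (intro sum.cong refl) (simp add: power_divide)
        finally show ?thesis by (simp only: sum_distrib_left)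
      qed
      thus ?thesis using xi by (simp add: sum_distrib_left mult_ac)
    qed
    also have "(\<Sum>c\<in>codes. \<Sum>j\<in>mates \<sigma> i. of_bool (j \<in> rivals \<sigma> c i l) * (x j / x i)\<^sup>2)
        = (\<Sum>j\<in>mates \<sigma> i. (\<Sum>c\<in>codes. of_bool (j \<in> rivals \<sigma> c i l)) * (x j / x i)\<^sup>2)"
      by (subst sum.swap) (simp add: sum_distrib_right)
    also have "16 * real (card signs) * (real (spread l))\<^sup>2 * \<dots> \<le> 16 * real (card signs) * (real (spread l))\<^sup>2
        * (\<Sum>j\<in>mates \<sigma> i. real (card codes) / 2 ^ bits_read l * (x j / x i)\<^sup>2)"
      by (intro mult_left_mono sum_mono mult_right_mono agree) auto
    also have "\<dots> = 16 * real (card codes) * real (card signs) * (\<Sum>j\<in>mates \<sigma> i. (x j / x i)\<^sup>2)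
                   * ((real (spread l))\<^sup>2 / 2 ^ bits_read l)"
      unfolding sum_distrib_left[symmetric] by simp
    finally show "(\<Sum>c\<in>codes. \<Sum>e\<in>signs. ?F c e l) \<le> \<dots>" .
  qed
  also have "\<dots> = 16 * real (card codes) * real (card signs) * (\<Sum>j\<in>mates \<sigma> i. (x j / x i)\<^sup>2)
                   * (\<Sum>l\<le>T. (real (spread l))\<^sup>2 / 2 ^ bits_read l)"
    by (simp only: sum_distrib_left)
  also have "\<dots> \<le> 16 * real (card codes) * real (card signs) * (\<Sum>j\<in>mates \<sigma> i. (x j / x i)\<^sup>2) * 33"
    by (intro mult_left_mono sum_spread_le) (auto intro!: mult_nonneg_nonneg sum_nonneg)
  finally show ?thesis by simp
qed

definition rounds :: "seed set" where
  "rounds = shifts \<times> codes \<times> signs"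

lemma finite_rounds: "finite rounds"
  using finite_samples by (simp add: rounds_def)

text \<open>
  Averaging over the shifts. For \<open>r < 2\<close> the expected noise energy is too large a bound, as one
  large coordinate can dominate it; but a probability is at most \<open>1\<close>, and \<open>min 1 (y\<^sup>2) \<le> \<bar>y\<bar> powr r\<close>
  lets every colliding coordinate enter with the power \<open>r\<close> only.
\<close>
lemma card_missed:
  fixes r :: real
  assumes i: "i < m" and xi: "x i \<noteq> 0" and r: "0 < r" "r \<le> 2"
  shows "real B * real (card {\<omega> \<in> rounds. missed x i \<omega>})
       \<le> 528 * real (card rounds) * (\<Sum>j<m. \<bar>x j / x i\<bar> powr r)"
proof -
  let ?N = "real (card codes) * real (card signs)"
  have step: "real (card {(c, e) \<in> codes \<times> signs. missed x i (\<sigma>, c, e)})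
       \<le> 528 * ?N * (\<Sum>j\<in>mates \<sigma> i. \<bar>x j / x i\<bar> powr r)" for \<sigma>
  proof -
    have min_le: "min 1 (\<Sum>j\<in>J. a j) \<le> (\<Sum>j\<in>J. min 1 (a j))" if "finite J" "\<And>j. a j \<ge> 0"
      for J :: "nat set" and a :: "nat \<Rightarrow> real"
      using that(1)
    proof (induction J)
      case (insert k J)
      have "(\<Sum>j\<in>J. min 1 (a j)) \<ge> 0" using that(2) by (intro sum_nonneg) simp
      thus ?case using insert that(2)[of k] by simp
    qed simp
    have pw: "min 1 (y\<^sup>2) \<le> \<bar>y\<bar> powr r" for y :: real
    proof (cases "\<bar>y\<bar> \<le> 1")
      case True
      have "y\<^sup>2 \<le> \<bar>y\<bar> powr r"
      proof (cases "y = 0")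
        case False
        hence "\<bar>y\<bar> powr 2 \<le> \<bar>y\<bar> powr r" using True r by (intro powr_mono') auto
        thus ?thesis using False by simp
      qed simp
      thus ?thesis by simp
    next
      case False
      hence "1 powr r \<le> \<bar>y\<bar> powr r" using r by (intro powr_mono2) auto
      thus ?thesis by simp
    qed
    let ?a = "\<Sum>j\<in>mates \<sigma> i. (x j / x i)\<^sup>2"
    have "{(c, e) \<in> codes \<times> signs. missed x i (\<sigma>, c, e)} \<subseteq> codes \<times> signs" by auto
    hence "card {(c, e) \<in> codes \<times> signs. missed x i (\<sigma>, c, e)} \<le> card (codes \<times> signs)"
      using finite_samples by (intro card_mono) auto
    hence triv: "real (card {(c, e) \<in> codes \<times> signs. missed x i (\<sigma>, c, e)}) \<le> ?N"
      by (simp add: card_cartesian_product flip: of_nat_mult)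
    have "real (card {(c, e) \<in> codes \<times> signs. missed x i (\<sigma>, c, e)}) \<le> 528 * ?N * min 1 ?a"
    proof (cases "?a \<le> 1")
      case True
      hence "min 1 ?a = ?a" by simp
      thus ?thesis using card_missed_given_shift[of i x \<sigma>, OF i xi] by (simp only: mult.assoc)
    next
      case False
      hence "min 1 ?a = 1" by simp
      moreover have "0 \<le> ?N" by simp
      ultimately show ?thesis using triv by linarith
    qed
    also have "\<dots> \<le> 528 * ?N * (\<Sum>j\<in>mates \<sigma> i. \<bar>x j / x i\<bar> powr r)"
    proof (rule mult_left_mono)
      have "min 1 ?a \<le> (\<Sum>j\<in>mates \<sigma> i. min 1 ((x j / x i)\<^sup>2))" by (rule min_le) auto
      also have "\<dots> \<le> (\<Sum>j\<in>mates \<sigma> i. \<bar>x j / x i\<bar> powr r)" by (intro sum_mono pw)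
      finally show "min 1 ?a \<le> (\<Sum>j\<in>mates \<sigma> i. \<bar>x j / x i\<bar> powr r)" .
    qed simp
    finally show ?thesis .
  qed
  have coll: "real B * (\<Sum>\<sigma>\<in>shifts. of_bool (j \<in> mates \<sigma> i)) \<le> real (card shifts)" if "j < m" for j
  proof (cases "j = i")
    case False
    have "(\<Sum>\<sigma>\<in>shifts. of_bool (j \<in> mates \<sigma> i)) = real (card {\<sigma> \<in> shifts. bucket \<sigma> j = bucket \<sigma> i})"
      using finite_samples that False by (simp add: sum.If_cases of_bool_def Int_def mates_def)
    moreover have "real (B * card {\<sigma> \<in> shifts. bucket \<sigma> j = bucket \<sigma> i}) \<le> real (card shifts)"
      using card_colliding_shifts[OF i that False] by (simp only: of_nat_le_iff)
    ultimately show ?thesis by simp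
  qed (simp add: mates_def)
  have split: "{\<omega> \<in> rounds. missed x i \<omega>} = Sigma shifts (\<lambda>\<sigma>. {(c, e) \<in> codes \<times> signs. missed x i (\<sigma>, c, e)})"
    by (auto simp: rounds_def)
  have "finite {(c, e) \<in> codes \<times> signs. missed x i (\<sigma>, c, e)}" for \<sigma>
    by (rule finite_subset[of _ "codes \<times> signs"]) (use finite_samples in auto)
  hence "card {\<omega> \<in> rounds. missed x i \<omega>} = (\<Sum>\<sigma>\<in>shifts. card {(c, e) \<in> codes \<times> signs. missed x i (\<sigma>, c, e)})"
    unfolding split by (intro card_SigmaI ballI finite_samples)
  hence "real (card {\<omega> \<in> rounds. missed x i \<omega>})
      \<le> (\<Sum>\<sigma>\<in>shifts. 528 * ?N * (\<Sum>j\<in>mates \<sigma> i. \<bar>x j / x i\<bar> powr r))"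
    by (simp only: of_nat_sum) (intro sum_mono step)
  also have "\<dots> = 528 * ?N * (\<Sum>\<sigma>\<in>shifts. \<Sum>j<m. of_bool (j \<in> mates \<sigma> i) * \<bar>x j / x i\<bar> powr r)"
  proof -
    have "(\<Sum>j\<in>mates \<sigma> i. \<bar>x j / x i\<bar> powr r) = (\<Sum>j<m. of_bool (j \<in> mates \<sigma> i) * \<bar>x j / x i\<bar> powr r)" for \<sigma>
      by (rule sum.mono_neutral_cong_left) (auto simp: mates_def)
    thus ?thesis by (simp only: sum_distrib_left)
  qed
  also have "\<dots> = 528 * ?N * (\<Sum>j<m. (\<Sum>\<sigma>\<in>shifts. of_bool (j \<in> mates \<sigma> i)) * \<bar>x j / x i\<bar> powr r)"
    by (subst sum.swap) (simp add: sum_distrib_right)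
  finally have "real B * real (card {\<omega> \<in> rounds. missed x i \<omega>})
     \<le> real B * (528 * ?N * (\<Sum>j<m. (\<Sum>\<sigma>\<in>shifts. of_bool (j \<in> mates \<sigma> i)) * \<bar>x j / x i\<bar> powr r))"
    by (intro mult_left_mono) auto
  also have "\<dots> = 528 * ?N * (\<Sum>j<m. real B * (\<Sum>\<sigma>\<in>shifts. of_bool (j \<in> mates \<sigma> i)) * \<bar>x j / x i\<bar> powr r)"
    by (simp add: sum_distrib_left mult_ac)
  also have "\<dots> \<le> 528 * ?N * (\<Sum>j<m. real (card shifts) * \<bar>x j / x i\<bar> powr r)"
    by (intro mult_left_mono sum_mono mult_right_mono coll) auto
  also have "\<dots> = 528 * real (card rounds) * (\<Sum>j<m. \<bar>x j / x i\<bar> powr r)"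
    by (simp add: rounds_def card_cartesian_product mult_ac flip: sum_distrib_left)
  finally show ?thesis .
qed

end

section \<open>The algorithm and its error on each coordinate\<close>

lemma length_info [simp]: "length (info d x t) = t"
  by (induction t) auto

lemma info_nth: "s < t \<Longrightarrow> info d x t ! s = query d (info d x s) x"
  by (induction t) (auto simp: nth_append less_Suc_eq)

context bucket_coding
begin

text \<open>
  Every bucket of every round owns a slot of consecutive measurements: two for each of the \<open>T + 1\<close>
  levels, and a last one that reads off the value.
\<close>
definition slot_length :: nat where
  "slot_length = 2 * (T + 1) + 1"

definition slot :: "nat \<Rightarrow> nat \<Rightarrow> nat" where
  "slot r b = (r * B + b) * slot_length"

definition decoded :: "real list \<Rightarrow> nat \<Rightarrow> nat \<Rightarrow> int" where
  "decoded ys s k = round (ys ! (s + (2 * k + 1)) / ys ! (s + 2 * k))"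

text \<open>
  Here \<open>\<kappa>\<close> is the sequence of decoded labels. It is integer valued because a failed level may decode
  anything.
\<close>
definition candidates :: "(nat \<Rightarrow> nat) \<Rightarrow> (nat \<Rightarrow> nat) \<Rightarrow> nat \<Rightarrow> (nat \<Rightarrow> int) \<Rightarrow> nat \<Rightarrow> nat set" where
  "candidates \<sigma> c b \<kappa> l = {j. j < m \<and> bucket \<sigma> j = b \<and> (\<forall>k<l. int (label c k j) = \<kappa> k)}"

text \<open>
  At position \<open>u = 2 * l\<close> of a slot the signed sum of level \<open>l\<close> is taken, at \<open>u = 2 * l + 1\<close> the one
  weighted by the labels. The last position \<open>2 * (T + 1)\<close> fits the same pattern: all labels
  are known there, which leaves at most one candidate.
\<close>
definition measurement ::
  "seed \<Rightarrow> nat \<Rightarrow> (nat \<Rightarrow> int) \<Rightarrow> nat \<Rightarrow> vec \<Rightarrow> real" where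
  "measurement = (\<lambda>(\<sigma>, c, e) b \<kappa> u x.
     \<Sum>j\<in>candidates \<sigma> c b \<kappa> (u div 2). e j * ((if even u then 1 else real (label c (u div 2) j)) * x j))"

definition probe :: "(nat \<Rightarrow> seed) \<Rightarrow> real list \<Rightarrow> vec \<Rightarrow> real" where
  "probe \<omega> ys = (let z = length ys div slot_length in
     measurement (\<omega> (z div B)) (z mod B) (decoded ys (z * slot_length)) (length ys mod slot_length))"

definition located :: "(nat \<Rightarrow> seed) \<Rightarrow> real list \<Rightarrow> nat \<Rightarrow> nat \<Rightarrow> bool" where
  "located \<omega> ys i r = (case \<omega> r of (\<sigma>, c, e) \<Rightarrow>
     i \<in> candidates \<sigma> c (bucket \<sigma> i) (decoded ys (slot r (bucket \<sigma> i))) (Suc T))"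

text \<open>
  An index may be located in several rounds. All of them give the same value, so the first one serves.
\<close>
definition reconstruct :: "nat \<Rightarrow> (nat \<Rightarrow> seed) \<Rightarrow> real list \<Rightarrow> vec" where
  "reconstruct R \<omega> ys i =
     (if \<exists>r<R. located \<omega> ys i r
      then let r = (LEAST r. located \<omega> ys i r) in
        case \<omega> r of (\<sigma>, c, e) \<Rightarrow> e i * ys ! (slot r (bucket \<sigma> i) + 2 * Suc T)
      else 0)"

definition algorithm :: "nat \<Rightarrow> (nat \<Rightarrow> seed) \<Rightarrow> det_alg" where
  "algorithm R \<omega> = Det_Alg (probe \<omega>) (\<lambda>ys. R * B * slot_length \<le> length ys) (reconstruct R \<omega>)"

lemma num_evals_algorithm: "num_evals (algorithm R \<omega>) x = R * B * slot_length"
  unfolding num_evals_def algorithm_def by (simp add: Least_equality)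

lemma linear_functional_measurement: "linear_functional m (measurement \<rho> b \<kappa> u)"
  by (cases \<rho>)
     (simp add: linear_functional_def measurement_def distrib_left distrib_right sum.distrib sum_distrib_left mult_ac)

lemma valid_algorithm: "valid_alg m (algorithm R \<omega>)"
proof -
  have "\<exists>k. halts (algorithm R \<omega>) (info (algorithm R \<omega>) x k)" for x
    by (rule exI[of _ "R * B * slot_length"]) (simp add: algorithm_def)
  moreover have "reconstruct R \<omega> ys \<in> Rn m" for ys
    by (auto simp: Rn_def reconstruct_def located_def candidates_def split: prod.splits)
  ultimately show ?thesis
    by (auto simp: valid_alg_def algorithm_def probe_def Let_def linear_functional_measurement)
qed

lemma candidates_cong: "(\<And>k. k < l \<Longrightarrow> \<kappa> k = \<kappa>' k) \<Longrightarrow> candidates \<sigma> c b \<kappa> l = candidates \<sigma> c b \<kappa>' l"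
  by (auto simp: candidates_def)

text \<open>
  The probe at a position of a slot sees only the values observed so far, but these contain all labels
  that it uses; so the decoded labels can be taken from the complete list of values.
\<close>
lemma slot_values:
  fixes \<omega> :: "nat \<Rightarrow> seed" and x :: vec
  assumes "r < R" "b < B" "u < slot_length"
  defines "ys \<equiv> info (algorithm R \<omega>) x (R * B * slot_length)"
  shows "ys ! (slot r b + u) = measurement (\<omega> r) b (decoded ys (slot r b)) u x"
proof -
  let ?d = "algorithm R \<omega>" and ?t = "slot r b + u"
  have "r * B + b < R * B"
  proof -
    have "r * B + b < Suc r * B" using assms(2) by simp
    also have "\<dots> \<le> R * B" using assms(1) by (intro mult_right_mono) auto
    finally show ?thesis .
  qed
  hence "Suc (r * B + b) * slot_length \<le> R * B * slot_length" by (intro mult_right_mono) auto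
  hence t: "?t < R * B * slot_length" using assms(3) by (simp add: slot_def)
  have pos: "0 < slot_length" by (simp add: slot_length_def)
  have dm: "?t div slot_length = r * B + b" "?t mod slot_length = u"
    using assms(3) by (simp_all add: slot_def)
  have dm2: "(r * B + b) div B = r" "(r * B + b) mod B = b" using assms(2) by simp_all
  have "ys ! ?t = probe \<omega> (info ?d x ?t) x"
    unfolding ys_def info_nth[OF t] by (simp add: algorithm_def)
  also have "\<dots> = measurement (\<omega> r) b (decoded (info ?d x ?t) (slot r b)) u x"
    unfolding probe_def Let_def length_info dm dm2 by (simp add: slot_def)
  also have "\<dots> = measurement (\<omega> r) b (decoded ys (slot r b)) u x"
  proof -
    have "decoded (info ?d x ?t) (slot r b) k = decoded ys (slot r b) k" if "k < u div 2" for k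
    proof -
      have a: "slot r b + (2 * k + 1) < ?t" "slot r b + 2 * k < ?t" using that by auto
      have "info ?d x ?t ! s = ys ! s" if "s < ?t" for s
        unfolding ys_def using that t by (simp add: info_nth)
      thus ?thesis using a by (simp only: decoded_def)
    qed
    hence "candidates \<sigma> c b (decoded (info ?d x ?t) (slot r b)) (u div 2)
         = candidates \<sigma> c b (decoded ys (slot r b)) (u div 2)" for \<sigma> c
      by (rule candidates_cong)
    thus ?thesis by (simp add: measurement_def case_prod_unfold)
  qed
  finally show ?thesis .
qed

lemma candidates_eq_rivals:
  assumes "i < m" "\<forall>k<l. \<kappa> k = int (label c k i)"
  shows "candidates \<sigma> c (bucket \<sigma> i) \<kappa> l = insert i (rivals \<sigma> c i l)"
  using assms by (auto simp: candidates_def rivals_def mates_def)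

text \<open>
  As long as all earlier labels are right, the candidates are \<open>i\<close> and its rivals, so that the two
  measurements are \<open>e i * x i + W\<close> and \<open>a\<close> times this value plus \<open>V\<close>, where \<open>a\<close> is the label of \<open>i\<close> and \<open>W\<close>, \<open>V\<close>
  are the two noise terms. Since \<open>2 * \<bar>V\<bar>\<close> is less than the absolute value of the first measurement,
  rounding the quotient yields \<open>a\<close>.
\<close>
lemma labels_decoded:
  assumes i: "i < m" and ei: "e i \<in> {-1, 1}" and hit: "\<not> missed x i (\<sigma>, c, e)"
    and y: "\<And>u. u < slot_length \<Longrightarrow> y u = measurement (\<sigma>, c, e) (bucket \<sigma> i) \<kappa> u x"
    and \<kappa>: "\<And>k. \<kappa> k = round (y (2 * k + 1) / y (2 * k))"
  shows "l \<le> Suc T \<Longrightarrow> \<forall>k<l. \<kappa> k = int (label c k i)"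
proof (induction l)
  case (Suc l)
  hence IH: "\<forall>k<l. \<kappa> k = int (label c k i)" and l: "l \<le> T" by auto
  let ?H = "rivals \<sigma> c i l" and ?a = "real (label c l i)"
  let ?W = "\<Sum>j\<in>?H. e j * x j"
  let ?V = "\<Sum>j\<in>?H. e j * ((real (label c l j) - ?a) * x j)"
  have cand: "candidates \<sigma> c (bucket \<sigma> i) \<kappa> l = insert i ?H"
    using i IH by (rule candidates_eq_rivals)
  have ni: "i \<notin> ?H" by (auto simp: rivals_def mates_def)
  have "y (2 * l) = measurement (\<sigma>, c, e) (bucket \<sigma> i) \<kappa> (2 * l) x"
    using l by (intro y) (simp add: slot_length_def)
  hence y1: "y (2 * l) = e i * x i + ?W" using ni by (simp add: measurement_def cand)
  have "y (2 * l + 1) = measurement (\<sigma>, c, e) (bucket \<sigma> i) \<kappa> (2 * l + 1) x"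
    using l by (intro y) (simp add: slot_length_def)
  hence "y (2 * l + 1) = e i * (?a * x i) + (\<Sum>j\<in>?H. e j * (real (label c l j) * x j))"
    using ni by (simp add: measurement_def cand)
  also have "(\<Sum>j\<in>?H. e j * (real (label c l j) * x j)) = ?V + ?a * ?W"
    by (simp add: sum_distrib_left algebra_simps flip: sum.distrib)
  finally have y2: "y (2 * l + 1) = ?a * y (2 * l) + ?V" using y1 by (simp add: algebra_simps)
  have W: "4 * \<bar>?W\<bar> < \<bar>x i\<bar>" and V: "4 * \<bar>?V\<bar> < \<bar>x i\<bar>"
    using hit l by (auto simp: missed_def not_le dest!: spec[of _ l])
  have "\<bar>e i * x i\<bar> = \<bar>x i\<bar>" using ei by auto
  hence big: "2 * \<bar>?V\<bar> < \<bar>y (2 * l)\<bar>" using y1 W V by linarith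
  hence "y (2 * l) \<noteq> 0" by auto
  hence "y (2 * l + 1) / y (2 * l) - ?a = ?V / y (2 * l)" using y2 by (simp add: field_simps)
  hence "\<bar>y (2 * l + 1) / y (2 * l) - of_int (int (label c l i))\<bar> < 1 / 2"
    using big \<open>y (2 * l) \<noteq> 0\<close> by (simp add: abs_divide field_simps)
  hence "\<kappa> l = int (label c l i)" unfolding \<kappa> by (rule round_unique')
  with IH show ?case by (auto simp: less_Suc_eq)
qed simp

text \<open>
  The output is never wrong about a located index: then \<open>i\<close> is the only candidate left, whether or not
  the round succeeded for \<open>i\<close>, and the last measurement of the slot is \<open>e i * x i\<close>.
\<close>
lemma algorithm_error:
  assumes x: "x \<in> Rn m" and i: "i < m" and \<omega>: "\<And>r. r < R \<Longrightarrow> \<omega> r \<in> rounds"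
  shows "\<bar>x i - alg_out (algorithm R \<omega>) x i\<bar> \<le> (if \<forall>r<R. missed x i (\<omega> r) then \<bar>x i\<bar> else 0)"
proof -
  define ys where "ys = info (algorithm R \<omega>) x (R * B * slot_length)"
  have out: "alg_out (algorithm R \<omega>) x = reconstruct R \<omega> ys"
    by (simp add: alg_out_def num_evals_algorithm ys_def) (simp add: algorithm_def)
  have sgn: "e i \<in> {-1, 1}" if "r < R" "\<omega> r = (\<sigma>, c, e)" for r \<sigma> c e
    using \<omega>[OF that(1)] that(2) i by (auto simp: rounds_def signs_def PiE_iff)
  have exact: "e i * ys ! (slot r (bucket \<sigma> i) + 2 * Suc T) = x i"
    if r: "r < R" and \<omega>r: "\<omega> r = (\<sigma>, c, e)" and loc: "located \<omega> ys i r" for r \<sigma> c e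
  proof -
    let ?\<kappa> = "decoded ys (slot r (bucket \<sigma> i))"
    have "candidates \<sigma> c (bucket \<sigma> i) ?\<kappa> (Suc T) = insert i (rivals \<sigma> c i (Suc T))"
      using loc \<omega>r by (intro candidates_eq_rivals i) (auto simp: located_def candidates_def)
    hence cand: "candidates \<sigma> c (bucket \<sigma> i) ?\<kappa> (Suc T) = {i}" by (simp only: rivals_empty)
    have "ys ! (slot r (bucket \<sigma> i) + 2 * Suc T) = measurement (\<sigma>, c, e) (bucket \<sigma> i) ?\<kappa> (2 * Suc T) x"
      unfolding ys_def \<omega>r[symmetric] by (intro slot_values r bucket_less) (simp add: slot_length_def)
    also have "\<dots> = e i * x i" by (simp add: measurement_def cand del: mult_Suc_right)
    finally show ?thesis using sgn[OF r \<omega>r] by auto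
  qed
  have found: "located \<omega> ys i r" if r: "r < R" and "\<not> missed x i (\<omega> r)" for r
  proof -
    obtain \<sigma> c e where \<omega>r: "\<omega> r = (\<sigma>, c, e)" by (cases "\<omega> r")
    let ?s = "slot r (bucket \<sigma> i)"
    have "\<forall>k<Suc T. decoded ys ?s k = int (label c k i)"
    proof (rule labels_decoded[where y = "\<lambda>u. ys ! (?s + u)"])
      show "ys ! (?s + u) = measurement (\<sigma>, c, e) (bucket \<sigma> i) (decoded ys ?s) u x"
        if "u < slot_length" for u
        unfolding ys_def \<omega>r[symmetric] by (intro slot_values r bucket_less that)
    qed (use i sgn[OF r \<omega>r] that(2) \<omega>r in \<open>simp_all add: decoded_def\<close>)
    thus ?thesis using i by (simp add: located_def \<omega>r candidates_def)
  qed
  show ?thesis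
  proof (cases "\<exists>r<R. located \<omega> ys i r")
    case True
    then obtain r0 where r0: "r0 < R" "located \<omega> ys i r0" by blast
    define r where "r = (LEAST r. located \<omega> ys i r)"
    have loc: "located \<omega> ys i r" unfolding r_def by (rule LeastI) (rule r0)
    have "r \<le> r0" unfolding r_def by (rule Least_le) (rule r0)
    hence "r < R" using r0 by simp
    obtain \<sigma> c e where \<omega>r: "\<omega> r = (\<sigma>, c, e)" by (cases "\<omega> r")
    have "alg_out (algorithm R \<omega>) x i = e i * ys ! (slot r (bucket \<sigma> i) + 2 * Suc T)"
      using True by (simp add: out reconstruct_def Let_def \<omega>r flip: r_def)
    thus ?thesis using exact[OF \<open>r < R\<close> \<omega>r loc] by simp
  next
    case False
    thus ?thesis using found by (auto simp: out reconstruct_def)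
  qed
qed

section \<open>The expected error\<close>

definition samples :: "nat \<Rightarrow> (nat \<Rightarrow> seed) set" where
  "samples R = {..<R} \<rightarrow>\<^sub>E rounds"

lemma card_rounds_pos: "0 < card rounds"
  using finite_rounds samples_nonempty unfolding card_gt_0_iff rounds_def by blast

lemma card_samples: "card (samples R) = card rounds ^ R"
  by (simp add: samples_def card_funcsetE)

lemma finite_samples_nonempty: "finite (samples R)" "samples R \<noteq> {}"
proof -
  have "0 < card (samples R)" using card_rounds_pos by (simp add: card_samples)
  thus "finite (samples R)" "samples R \<noteq> {}" by (simp_all only: card_gt_0_iff not_False_eq_True)
qed

lemma ran_alg_algorithm: "ran_alg m (measure_pmf (pmf_of_set (samples R))) (algorithm R)"
  by (simp add: ran_alg_def valid_algorithm prob_space_measure_pmf)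

lemma ran_card_algorithm:
  "ran_card m (measure_pmf (pmf_of_set (samples R))) (algorithm R) \<le> enat (R * B * (2 * T + 3))"
proof -
  have "slot_length = 2 * T + 3" by (simp add: slot_length_def)
  thus ?thesis unfolding ran_card_def num_evals_algorithm by (intro SUP_least) (simp only: order.refl)
qed

lemma card_all_missed:
  "card {\<omega> \<in> samples R. \<forall>r<R. missed x i (\<omega> r)} = card {\<rho> \<in> rounds. missed x i \<rho>} ^ R"
proof -
  have "{\<omega> \<in> samples R. \<forall>r<R. missed x i (\<omega> r)} = {..<R} \<rightarrow>\<^sub>E {\<rho> \<in> rounds. missed x i \<rho>}"
    unfolding samples_def PiE_iff set_eq_iff mem_Collect_eq Ball_def lessThan_iff by blast
  thus ?thesis by (simp add: card_funcsetE)
qed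

text \<open>
  With \<open>u = (\<mu> / B) / \<bar>x i\<bar> powr r\<close>, a round misses \<open>i\<close> with probability at most \<open>528 * min 1 u\<close>.
  The \<open>R\<close> rounds are independent and \<open>(min 1 u) ^ R \<le> u powr ((q - p) / r)\<close>. This exponent turns
  the factor \<open>\<bar>x i\<bar> powr q\<close> into \<open>\<bar>x i\<bar> powr p\<close>, which is summable on the unit ball.
\<close>
lemma missed_contribution:
  fixes p q r \<mu> :: real
  assumes i: "i < m" and pq: "0 < p" "p < q" and r: "0 < r" "r \<le> 2" and R: "q - p \<le> real R * r"
    and \<mu>: "0 < \<mu>" "(\<Sum>j<m. \<bar>x j\<bar> powr r) \<le> \<mu>"
  shows "\<bar>x i\<bar> powr q * real (card {\<omega> \<in> samples R. \<forall>r<R. missed x i (\<omega> r)})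
     \<le> real (card (samples R)) * (528 ^ R * (\<mu> / real B) powr ((q - p) / r)) * \<bar>x i\<bar> powr p"
proof (cases "x i = 0")
  case False
  let ?a = "\<bar>x i\<bar>" and ?n = "real (card rounds)" and ?\<tau> = "\<mu> / real B" and ?s = "(q - p) / r"
  define P where "P = real (card {\<rho> \<in> rounds. missed x i \<rho>}) / ?n"
  define u where "u = ?\<tau> / ?a powr r"
  have n: "?n > 0" using card_rounds_pos by simp
  have a: "?a > 0" using False by simp
  have \<tau>: "?\<tau> > 0" using \<mu>(1) B_pos by simp
  have u: "u > 0" unfolding u_def using a by (intro divide_pos_pos \<tau>) simp
  have s: "0 < ?s" "?s \<le> real R" using pq r R by (simp_all add: pos_divide_le_eq)
  have P0: "P \<ge> 0" by (simp add: P_def)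
  have P1: "P \<le> 1"
  proof -
    have "card {\<rho> \<in> rounds. missed x i \<rho>} \<le> card rounds" by (intro card_mono finite_rounds) auto
    thus ?thesis using n by (simp add: P_def)
  qed
  have P2: "P \<le> 528 * u"
  proof -
    have "(\<Sum>j<m. \<bar>x j / x i\<bar> powr r) = (\<Sum>j<m. \<bar>x j\<bar> powr r) / ?a powr r"
      by (simp add: sum_divide_distrib powr_divide)
    also have "\<dots> \<le> \<mu> / ?a powr r" using \<mu> by (intro divide_right_mono) auto
    finally have "528 * ?n * (\<Sum>j<m. \<bar>x j / x i\<bar> powr r) \<le> 528 * ?n * (\<mu> / ?a powr r)"
      by (intro mult_left_mono) auto
    with card_missed[where x = x, OF i False r]
    have "real B * real (card {\<rho> \<in> rounds. missed x i \<rho>}) \<le> 528 * ?n * (\<mu> / ?a powr r)" by linarith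
    hence "real (card {\<rho> \<in> rounds. missed x i \<rho>}) \<le> 528 * ?n * (\<mu> / ?a powr r) / real B"
      using B_pos by (simp only: pos_le_divide_eq of_nat_0_less_iff mult.commute)
    also have "\<dots> = 528 * u * ?n" by (simp add: u_def mult_ac)
    finally show ?thesis using n by (simp add: P_def pos_divide_le_eq)
  qed
  have "P \<le> 528 * min 1 u" using P1 P2 by (simp add: min_def)
  hence "P ^ R \<le> (528 * min 1 u) ^ R" using P0 by (rule power_mono)
  also have "\<dots> = 528 ^ R * (min 1 u) ^ R" by (rule power_mult_distrib)
  also have "(min 1 u) ^ R \<le> u powr ?s"
  proof (cases "u \<le> 1")
    case True
    have "u ^ R = u powr real R" using u by (simp add: powr_realpow)
    also have "\<dots> \<le> u powr ?s" using s u True by (intro powr_mono') auto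
    finally show ?thesis using True by (simp add: min_def)
  next
    case False
    hence "1 powr ?s \<le> u powr ?s" using s by (intro powr_mono2) auto
    thus ?thesis using False by (simp add: min_def)
  qed
  also have "u powr ?s = ?\<tau> powr ?s / ?a powr (q - p)"
  proof -
    have "u powr ?s = ?\<tau> powr ?s / (?a powr r) powr ?s"
      unfolding u_def by (rule powr_divide)
    moreover have "r * ?s = q - p" using r by simp
    ultimately show ?thesis by (simp only: powr_powr)
  qed
  finally have PR: "P ^ R \<le> 528 ^ R * (?\<tau> powr ?s / ?a powr (q - p))" by simp
  have "?a powr q = ?a powr p * ?a powr (q - p)" by (simp flip: powr_add)
  hence "?a powr q * P ^ R \<le> ?a powr p * ?a powr (q - p) * (528 ^ R * (?\<tau> powr ?s / ?a powr (q - p)))"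
    using PR by (simp only:) (intro mult_left_mono; simp)
  also have "\<dots> = 528 ^ R * ?\<tau> powr ?s * ?a powr p" using a by simp
  finally have "?n ^ R * (?a powr q * P ^ R) \<le> ?n ^ R * (528 ^ R * ?\<tau> powr ?s * ?a powr p)"
    by (intro mult_left_mono) auto
  moreover have "real (card {\<omega> \<in> samples R. \<forall>r<R. missed x i (\<omega> r)}) = ?n ^ R * P ^ R"
    using n by (simp add: card_all_missed P_def power_divide)
  ultimately show ?thesis by (simp add: card_samples mult_ac)
qed (use pq in simp)

text \<open>
  To pass from the \<open>q\<close>-th power of the error to the error itself, concavity of the root is used in the form
  \<open>Y powr (1 / q) \<le> \<kappa> powr (1 / q) * (1 + Y / \<kappa>)\<close>, where \<open>Y\<close> is the sum of
  \<open>\<bar>x i\<bar> powr q\<close> over the coordinates missed in all rounds and \<open>\<kappa>\<close> bounds its mean.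
\<close>
lemma average_error:
  fixes p q r \<mu> :: real
  assumes x: "x \<in> Rn m" and pq: "1 \<le> p" "p < q" and r: "0 < r" "r \<le> 2" and R: "q - p \<le> real R * r"
    and \<mu>: "0 < \<mu>" "(\<Sum>j<m. \<bar>x j\<bar> powr r) \<le> \<mu>" and xp: "(\<Sum>j<m. \<bar>x j\<bar> powr p) \<le> 1"
  shows "(\<Sum>\<omega>\<in>samples R. pnorm m q (\<lambda>i. x i - alg_out (algorithm R \<omega>) x i)) / real (card (samples R))
      \<le> 2 * 528 powr (real R / q) * (\<mu> / real B) powr ((1 - p / q) / r)"
proof -
  let ?all = "\<lambda>\<omega> i. \<forall>r<R. missed x i (\<omega> r)" and ?N = "real (card (samples R))"
  define \<kappa> where "\<kappa> = 528 ^ R * (\<mu> / real B) powr ((q - p) / r)"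
  define Y where "Y \<omega> = (\<Sum>i<m. \<bar>x i\<bar> powr q * of_bool (?all \<omega> i))" for \<omega>
  have \<tau>: "0 < \<mu> / real B" using \<mu>(1) B_pos by simp
  have \<kappa>: "\<kappa> > 0" unfolding \<kappa>_def using \<mu>(1) B_pos by (intro mult_pos_pos) auto
  have q: "q > 1" using pq by simp
  have N: "?N > 0" using card_samples[of R] card_rounds_pos by simp
  have Y0: "Y \<omega> \<ge> 0" for \<omega> by (auto simp: Y_def intro!: sum_nonneg)
  have pt: "pnorm m q (\<lambda>i. x i - alg_out (algorithm R \<omega>) x i) \<le> \<kappa> powr (1 / q) * (1 + Y \<omega> / \<kappa>)"
    if \<omega>: "\<omega> \<in> samples R" for \<omega>
  proof -
    let ?z = "\<lambda>i. x i - alg_out (algorithm R \<omega>) x i"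
    have "(\<Sum>i<m. \<bar>?z i\<bar> powr q) \<le> Y \<omega>"
      unfolding Y_def
    proof (rule sum_mono)
      fix i assume "i \<in> {..<m}"
      hence "\<bar>?z i\<bar> \<le> (if ?all \<omega> i then \<bar>x i\<bar> else 0)"
        using \<omega> by (intro algorithm_error x) (auto simp: samples_def PiE_iff)
      hence "\<bar>?z i\<bar> powr q \<le> (if ?all \<omega> i then \<bar>x i\<bar> else 0) powr q"
        using q by (intro powr_mono2) auto
      also have "(if ?all \<omega> i then \<bar>x i\<bar> else 0) powr q = \<bar>x i\<bar> powr q * of_bool (?all \<omega> i)"
        by (cases "?all \<omega> i") auto
      finally show "\<bar>?z i\<bar> powr q \<le> \<bar>x i\<bar> powr q * of_bool (?all \<omega> i)" .
    qed
    hence "pnorm m q ?z \<le> Y \<omega> powr (1 / q)"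
      unfolding pnorm_def using q by (intro powr_mono2) (auto intro!: sum_nonneg)
    also have "Y \<omega> powr (1 / q) = \<kappa> powr (1 / q) * (Y \<omega> / \<kappa>) powr (1 / q)"
      using \<kappa> Y0[of \<omega>] by (simp add: powr_divide)
    also have "(Y \<omega> / \<kappa>) powr (1 / q) \<le> 1 + Y \<omega> / \<kappa>"
    proof -
      have "(Y \<omega> / \<kappa>) powr (1 / q) \<le> (1 + Y \<omega> / \<kappa>) powr (1 / q)"
        using \<kappa> Y0[of \<omega>] q by (intro powr_mono2) auto
      also have "\<dots> \<le> (1 + Y \<omega> / \<kappa>) powr 1" using \<kappa> Y0[of \<omega>] q by (intro powr_mono) auto
      finally show ?thesis using \<kappa> Y0[of \<omega>] by simp
    qed
    finally show ?thesis by (simp add: mult_left_mono)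
  qed
  have "(\<Sum>\<omega>\<in>samples R. Y \<omega>) = (\<Sum>i<m. \<bar>x i\<bar> powr q * real (card {\<omega> \<in> samples R. ?all \<omega> i}))"
    unfolding Y_def using finite_samples_nonempty(1)[of R]
    by (subst sum.swap) (simp add: sum.If_cases of_bool_def Int_def flip: sum_distrib_left)
  also have "\<dots> \<le> (\<Sum>i<m. ?N * \<kappa> * \<bar>x i\<bar> powr p)"
    unfolding \<kappa>_def using pq r R \<mu> by (intro sum_mono missed_contribution) auto
  also have "\<dots> = ?N * \<kappa> * (\<Sum>i<m. \<bar>x i\<bar> powr p)" by (simp add: sum_distrib_left)
  also have "\<dots> \<le> ?N * \<kappa> * 1" using xp \<kappa> by (intro mult_left_mono) auto
  finally have EY: "(\<Sum>\<omega>\<in>samples R. Y \<omega>) / \<kappa> \<le> ?N" using \<kappa> by (simp add: field_simps)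
  have "(\<Sum>\<omega>\<in>samples R. pnorm m q (\<lambda>i. x i - alg_out (algorithm R \<omega>) x i))
      \<le> (\<Sum>\<omega>\<in>samples R. \<kappa> powr (1 / q) * (1 + Y \<omega> / \<kappa>))"
    by (intro sum_mono pt)
  also have "\<dots> = \<kappa> powr (1 / q) * (?N + (\<Sum>\<omega>\<in>samples R. Y \<omega>) / \<kappa>)"
    by (simp add: sum.distrib sum_divide_distrib flip: sum_distrib_left)
  also have "\<dots> \<le> \<kappa> powr (1 / q) * (2 * ?N)" using EY by (intro mult_left_mono) auto
  finally have "(\<Sum>\<omega>\<in>samples R. pnorm m q (\<lambda>i. x i - alg_out (algorithm R \<omega>) x i)) / ?N \<le> 2 * \<kappa> powr (1 / q)"
    using N by (simp add: field_simps)
  also have "\<kappa> powr (1 / q) = 528 powr (real R / q) * (\<mu> / real B) powr ((1 - p / q) / r)"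
  proof -
    have "\<kappa> = 528 powr real R * (\<mu> / real B) powr ((q - p) / r)" by (simp add: \<kappa>_def powr_realpow)
    moreover have "(q - p) / r * (1 / q) = (1 - p / q) / r" using q by (simp add: field_simps)
    ultimately show ?thesis using \<tau> by (simp add: powr_mult powr_powr)
  qed
  finally show ?thesis by simp
qed

end

section \<open>Norms on the unit ball and the resulting randomized algorithm\<close>

lemma sum_powr_le_1:
  assumes "0 < p" "pnorm m p x \<le> 1"
  shows "(\<Sum>j<m. \<bar>x j\<bar> powr p) \<le> 1"
proof -
  let ?S = "\<Sum>j<m. \<bar>x j\<bar> powr p"
  have S: "?S \<ge> 0" by (intro sum_nonneg) simp
  have "(?S powr (1 / p)) powr p \<le> 1 powr p"
    using assms by (intro powr_mono2) (auto simp: pnorm_def)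
  thus ?thesis using assms S by (simp add: powr_powr)
qed

text \<open>
  Hoelder's inequality on the unit ball, obtained by summing the weighted inequality of arithmetic and
  geometric means for \<open>m * \<bar>x j\<bar> powr p\<close> and \<open>1\<close>.
\<close>
lemma sum_squares_le:
  fixes p :: real
  assumes p: "p > 2" and xp: "(\<Sum>j<m. \<bar>x j\<bar> powr p) \<le> 1" and m: "m > 0"
  shows "(\<Sum>j<m. \<bar>x j\<bar> powr 2) \<le> real m powr (1 - 2 / p)"
proof -
  have pt: "real m powr (2 / p) * \<bar>y\<bar> powr 2 \<le> 2 / p * (real m * \<bar>y\<bar> powr p) + (1 - 2 / p)" for y :: real
  proof (cases "y = 0")
    case False
    have "(real m * \<bar>y\<bar> powr p) powr (2 / p) * 1 powr (1 - 2 / p) \<le> 2 / p * (real m * \<bar>y\<bar> powr p) + (1 - 2 / p) * 1"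
      using p m False by (intro Youngs_inequality_0) auto
    thus ?thesis using p by (simp add: powr_mult powr_powr)
  qed (use p in simp)
  have "real m powr (2 / p) * (\<Sum>j<m. \<bar>x j\<bar> powr 2) \<le> (\<Sum>j<m. 2 / p * (real m * \<bar>x j\<bar> powr p) + (1 - 2 / p))"
    unfolding sum_distrib_left by (intro sum_mono pt)
  also have "\<dots> = 2 / p * real m * (\<Sum>j<m. \<bar>x j\<bar> powr p) + real m * (1 - 2 / p)"
    by (simp add: sum.distrib sum_distrib_left mult.assoc)
  also have "\<dots> \<le> 2 / p * real m * 1 + real m * (1 - 2 / p)"
    using xp p by (intro add_right_mono mult_left_mono) auto
  also have "\<dots> = real m" by (simp add: field_simps)
  also have "\<dots> = real m powr (2 / p) * real m powr (1 - 2 / p)" using m by (simp flip: powr_add)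
  finally show ?thesis using m by simp
qed

text \<open>
  The two cases of the theorem differ only in this quantity, the bound \<open>\<mu>\<close> for the sum of
  \<open>\<bar>x j\<bar> powr min p 2\<close>, and in the exponent \<open>rate\<close> below.
\<close>
definition noise_bound :: "real \<Rightarrow> nat \<Rightarrow> real" where
  "noise_bound p m = (if p \<le> 2 then 1 else real m powr (1 - 2 / p))"

lemma sum_min_powr_le_noise_bound:
  assumes "0 < p" "(\<Sum>j<m. \<bar>x j\<bar> powr p) \<le> 1" "m > 0"
  shows "(\<Sum>j<m. \<bar>x j\<bar> powr min p 2) \<le> noise_bound p m"
proof (cases "p \<le> 2")
  case False
  thus ?thesis using sum_squares_le[of p x m] assms by (simp add: noise_bound_def)
qed (use assms in \<open>simp add: noise_bound_def\<close>)

lemma noise_bound_ge_1: "m > 0 \<Longrightarrow> 0 < p \<Longrightarrow> noise_bound p m \<ge> 1"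
  by (auto simp: noise_bound_def intro!: ge_one_powr_ge_zero)

definition repetitions :: "real \<Rightarrow> real \<Rightarrow> nat" where
  "repetitions p q = nat \<lceil>q - p\<rceil>"

definition error_constant :: "real \<Rightarrow> real \<Rightarrow> real" where
  "error_constant p q = 2 * 528 powr (real (repetitions p q) / q)"

definition rate :: "real \<Rightarrow> real \<Rightarrow> real" where
  "rate p q = (1 - p / q) / min p 2"

lemma error_constant_ge_1: "0 < q \<Longrightarrow> error_constant p q \<ge> 1"
proof -
  assume "0 < q"
  hence "528 powr (real (repetitions p q) / q) \<ge> (1::real)" by (intro ge_one_powr_ge_zero) auto
  thus ?thesis by (simp add: error_constant_def)
qed

lemma ln_ln_ge_half:
  fixes z :: real
  assumes "z \<ge> 16"
  shows "ln (ln z) \<ge> 1 / 2"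
proof -
  have "exp (1 / 2) * exp (1 / 2) = exp (1::real)" by (simp flip: exp_add)
  hence "(exp (1 / 2))\<^sup>2 \<le> (2::real)\<^sup>2" using exp_le by (simp add: power2_eq_square)
  hence "exp (1 / 2) \<le> (2::real)" by (rule power2_le_imp_le) simp
  hence "exp (exp (1 / 2)) \<le> exp (2::real)" by simp
  also have "exp (2::real) = exp 1 * exp 1" by (simp flip: exp_add)
  also have "exp 1 * exp 1 \<le> 3 * (3::real)" using exp_le by (intro mult_mono) auto
  finally have "exp (exp (1 / 2)) \<le> z" using assms by linarith
  hence half: "exp (1 / 2) \<le> ln z" using assms by (subst ln_ge_iff) auto
  moreover have "0 < ln z" using half exp_gt_zero[of "1 / 2 :: real"] by linarith
  ultimately show ?thesis by (subst ln_ge_iff)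
qed

text \<open>
  The trade-off between cost and error, with the number \<open>B\<close> of buckets as a free parameter; \<open>z\<close> is
  any bound for the mean bucket size. The cost per bucket and round, \<open>2 * T + 3\<close>, is at most
  \<open>10 * L + 25 \<le> 60 * L\<close> with \<open>L = ln (ln z) \<ge> 1 / 2\<close>.
\<close>
lemma bucket_algorithm:
  assumes pq: "1 \<le> p" "p < q" and m: "m > 0" and B: "B > 0"
    and z: "z \<ge> 16" "real m / real B \<le> z"
  obtains M :: "(nat \<Rightarrow> seed) measure" and A and N :: nat
  where "ran_alg m M A" "ran_card m M A \<le> enat N"
    "real N \<le> 60 * real (repetitions p q) * real B * ln (ln z)"
    "ran_err p q m M A \<le> ennreal (error_constant p q * (noise_bound p m / real B) powr rate p q)"
proof -
  let ?R = "repetitions p q" and ?r = "min p 2"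
  have "real (m div B) \<le> real m / real B"
  proof -
    have "real (m div B * B) \<le> real m" by (simp only: of_nat_le_iff div_times_less_eq_dividend)
    thus ?thesis using B by (simp add: pos_le_divide_eq)
  qed
  hence "real (m div B + 1) \<le> z + 1" using z by simp
  then obtain T where T: "(m div B + 1)\<^sup>2 \<le> 2 ^ bits_read T" "real T \<le> 5 * ln (ln z) + 11"
    using exists_level_count[OF z(1)] by blast
  interpret bucket_coding m B T by unfold_locales (use B T in auto)
  let ?M = "measure_pmf (pmf_of_set (samples ?R))"
  have lam: "ln (ln z) \<ge> 1 / 2" using z(1) by (rule ln_ln_ge_half)
  have R1: "real ?R \<ge> q - p" unfolding repetitions_def by linarith
  have R2: "q - p \<le> real ?R * ?r"
  proof -
    have "real ?R * 1 \<le> real ?R * ?r" using pq by (intro mult_left_mono) auto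
    thus ?thesis using R1 by linarith
  qed
  have err: "ran_err p q m ?M (algorithm ?R)
      \<le> ennreal (error_constant p q * (noise_bound p m / real B) powr rate p q)"
    unfolding ran_err_def
  proof (rule SUP_least)
    fix x assume "x \<in> {x \<in> Rn m. pnorm m p x \<le> 1}"
    hence x: "x \<in> Rn m" and "pnorm m p x \<le> 1" by auto
    hence xp: "(\<Sum>j<m. \<bar>x j\<bar> powr p) \<le> 1" using pq by (intro sum_powr_le_1) auto
    let ?f = "\<lambda>\<omega>. pnorm m q (\<lambda>i. x i - alg_out (algorithm ?R \<omega>) x i)"
    have "(\<integral>\<^sup>+\<omega>. ennreal (?f \<omega>) \<partial>?M) = (\<Sum>\<omega>\<in>samples ?R. ennreal (?f \<omega>)) / ennreal (real (card (samples ?R)))"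
      using finite_samples_nonempty[of ?R] by (simp add: nn_integral_pmf_of_set ennreal_of_nat_eq_real_of_nat)
    also have "\<dots> = ennreal ((\<Sum>\<omega>\<in>samples ?R. ?f \<omega>) / real (card (samples ?R)))"
      using card_samples[of ?R] card_rounds_pos by (subst sum_ennreal) (auto simp: pnorm_def divide_ennreal sum_nonneg)
    also have "\<dots> \<le> ennreal (error_constant p q * (noise_bound p m / real B) powr rate p q)"
    proof (rule ennreal_leI)
      have "noise_bound p m > 0" using noise_bound_ge_1[OF m, of p] pq by simp
      moreover have "(\<Sum>j<m. \<bar>x j\<bar> powr ?r) \<le> noise_bound p m"
        using pq xp m by (intro sum_min_powr_le_noise_bound) auto
      ultimately show "(\<Sum>\<omega>\<in>samples ?R. ?f \<omega>) / real (card (samples ?R))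
          \<le> error_constant p q * (noise_bound p m / real B) powr rate p q"
        unfolding error_constant_def rate_def using pq R2 by (intro average_error x xp) auto
    qed
    finally show "(\<integral>\<^sup>+\<omega>. ennreal (?f \<omega>) \<partial>?M) \<le> ennreal (error_constant p q * (noise_bound p m / real B) powr rate p q)" .
  qed
  have "real (?R * B * (2 * T + 3)) = real ?R * real B * (2 * real T + 3)" by simp
  also have "\<dots> \<le> real ?R * real B * (60 * ln (ln z))"
    using T(2) lam by (intro mult_left_mono) auto
  finally have "real (?R * B * (2 * T + 3)) \<le> 60 * real ?R * real B * ln (ln z)" by (simp add: mult_ac)
  from that[OF ran_alg_algorithm ran_card_algorithm this err] show thesis .
qed

text \<open>
  The output \<open>0\<close> without any measurement suffices, since the \<open>q\<close>-norm is at most the \<open>p\<close>-norm.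
\<close>
lemma e_ran_le_1:
  assumes "1 \<le> p" "p < q"
  shows "e_ran n p q m \<le> 1"
proof -
  define A where "A = (\<lambda>_ :: unit. Det_Alg (\<lambda>_ _. 0) (\<lambda>_. True) (\<lambda>_ _. 0))"
  let ?M = "measure_pmf (return_pmf ())"
  have ev: "num_evals (A \<omega>) x = 0" for \<omega> x by (simp add: num_evals_def A_def)
  have out: "alg_out (A \<omega>) x = (\<lambda>_. 0)" for \<omega> x by (simp add: alg_out_def A_def)
  have "ran_alg m ?M A"
    by (auto simp: ran_alg_def prob_space_measure_pmf valid_alg_def A_def linear_functional_def Rn_def)
  moreover have "ran_card m ?M A \<le> enat n"
    unfolding ran_card_def by (intro SUP_least) (simp add: ev)
  ultimately have "e_ran n p q m \<le> ran_err p q m ?M A" by (rule e_ran_le)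
  also have "\<dots> \<le> 1"
    unfolding ran_err_def
  proof (rule SUP_least)
    fix x assume "x \<in> {x \<in> Rn m. pnorm m p x \<le> 1}"
    hence xp: "(\<Sum>j<m. \<bar>x j\<bar> powr p) \<le> 1" using assms by (intro sum_powr_le_1) auto
    have "(\<Sum>j<m. \<bar>x j\<bar> powr q) \<le> (\<Sum>j<m. \<bar>x j\<bar> powr p)"
    proof (rule sum_mono)
      fix i assume "i \<in> {..<m}"
      hence "\<bar>x i\<bar> powr p \<le> (\<Sum>j<m. \<bar>x j\<bar> powr p)" by (intro member_le_sum) auto
      hence "\<bar>x i\<bar> powr p \<le> 1" using xp by linarith
      hence "(\<bar>x i\<bar> powr p) powr (1 / p) \<le> 1 powr (1 / p)" using assms by (intro powr_mono2) auto
      hence "\<bar>x i\<bar> \<le> 1" using assms by (simp add: powr_powr)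
      thus "\<bar>x i\<bar> powr q \<le> \<bar>x i\<bar> powr p" using assms
        by (cases "x i = 0") (auto intro!: powr_mono')
    qed
    hence "(\<Sum>j<m. \<bar>x j\<bar> powr q) powr (1 / q) \<le> 1 powr (1 / q)"
      using xp assms by (intro powr_mono2) (auto intro!: sum_nonneg)
    hence "pnorm m q x \<le> 1" by (simp add: pnorm_def)
    thus "(\<integral>\<^sup>+\<omega>. ennreal (pnorm m q (\<lambda>i. x i - alg_out (A \<omega>) x i)) \<partial>?M) \<le> 1"
      by (simp add: out)
  qed
  finally show ?thesis .
qed

section \<open>Choice of the number of buckets\<close>

lemma rate_pos: "1 \<le> p \<Longrightarrow> p < q \<Longrightarrow> rate p q > 0"
  by (simp add: rate_def)

lemma scaled_dimension_ge_16:
  fixes p q \<epsilon> :: real and m :: nat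
  assumes "1 \<le> p" "p < q" "m > 0" "(16 / real m) powr (1/p - 1/q) \<le> \<epsilon>"
  shows "real m * \<epsilon> powr (1 / (1/p - 1/q)) \<ge> 16"
proof -
  define D where "D = 1/p - 1/q"
  have D: "D > 0" using assms by (simp add: D_def field_simps)
  have "((16 / real m) powr D) powr (1 / D) \<le> \<epsilon> powr (1 / D)"
    using assms(4) D unfolding D_def by (intro powr_mono2) auto
  hence "16 / real m \<le> \<epsilon> powr (1 / D)" using D assms(3) by (simp add: powr_powr)
  thus ?thesis using assms(3) by (simp add: D_def pos_divide_le_eq mult.commute)
qed

text \<open>
  Choose \<open>B\<close> minimal such that the error bound is at most \<open>\<epsilon>\<close>. For this \<open>B\<close> the mean bucket size
  \<open>m / B\<close> is at most \<open>z = m * \<epsilon> powr (1 / (1/p - 1/q))\<close>. This is immediate for \<open>p \<le> 2\<close>; for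
  \<open>p > 2\<close> the additional factor \<open>z powr (1 - 2 / p)\<close> in the number of buckets only helps.
\<close>
lemma n_ran_bound:
  fixes p q \<epsilon> :: real and m :: nat
  assumes pq: "1 \<le> p" "p < q" and m: "m \<ge> 16" and \<epsilon>: "(16 / real m) powr (1/p - 1/q) \<le> \<epsilon>" "\<epsilon> < 1"
  shows "ereal_of_enat (n_ran \<epsilon> p q m) \<le> ereal (120 * real (repetitions p q) * error_constant p q powr (1 / rate p q)
     * (noise_bound p m * \<epsilon> powr (-1 / rate p q) * ln (ln (real m * \<epsilon> powr (1 / (1/p - 1/q))))))"
proof -
  let ?C = "error_constant p q" and ?\<theta> = "rate p q" and ?\<mu> = "noise_bound p m" and ?D = "1/p - 1/q"
  define w where "w = \<epsilon> powr (1 / ?D)"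
  define z where "z = real m * w"
  define b where "b = ?\<mu> * (?C / \<epsilon>) powr (1 / ?\<theta>)"
  define B where "B = nat \<lceil>b\<rceil>"
  have D: "?D > 0" using pq by (simp add: field_simps)
  have \<theta>: "?\<theta> > 0" using pq by (rule rate_pos)
  have C: "?C \<ge> 1" using pq by (intro error_constant_ge_1) simp
  have \<mu>: "?\<mu> \<ge> 1" using pq m by (intro noise_bound_ge_1) auto
  have e0: "\<epsilon> > 0"
  proof -
    have "0 < (16 / real m) powr ?D" using m by simp
    thus ?thesis using \<epsilon>(1) by linarith
  qed
  have w0: "w > 0" using e0 by (simp add: w_def)
  have z: "z \<ge> 16"
    unfolding z_def w_def using pq m \<epsilon>(1) by (intro scaled_dimension_ge_16) auto
  have ew: "\<epsilon> powr (-1 / ?\<theta>) = w powr (- (?D / ?\<theta>))"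
  proof -
    have "1 / d * (- (d / ?\<theta>)) = -1 / ?\<theta>" if "d > 0" for d using that by simp
    from this[OF D] have "1 / ?D * (- (?D / ?\<theta>)) = -1 / ?\<theta>" .
    thus ?thesis by (simp only: w_def powr_powr)
  qed
  have bC: "b = ?C powr (1 / ?\<theta>) * (?\<mu> * \<epsilon> powr (-1 / ?\<theta>))"
    using C e0 by (simp add: b_def powr_divide powr_minus_divide)
  have C1: "?C powr (1 / ?\<theta>) \<ge> 1" using C \<theta> by (intro ge_one_powr_ge_zero) auto
  (* Since m / z = 1 / w, this bounds the mean bucket size by z. *)
  have low: "1 / w \<le> ?\<mu> * \<epsilon> powr (-1 / ?\<theta>)"
  proof (cases "p \<le> 2")
    case True
    hence "?\<theta> = ?D" using pq by (simp add: rate_def field_simps)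
    hence one: "?D / ?\<theta> = 1" using \<theta> by (metis divide_self less_irrefl)
    show ?thesis using True w0 unfolding ew one by (simp add: noise_bound_def powr_minus_divide)
  next
    case False
    have two: "?D / ?\<theta> = 2 / p" using False pq by (simp add: rate_def field_simps)
    have "?\<mu> * \<epsilon> powr (-1 / ?\<theta>) = real m powr (1 - 2 / p) * w powr (- (2 / p))"
      using False unfolding ew two by (simp add: noise_bound_def)
    also have "w powr (- (2 / p)) = w powr (1 - 2 / p) * w powr (- 1)"
      unfolding powr_add[symmetric] by simp
    also have "real m powr (1 - 2 / p) * \<dots> = z powr (1 - 2 / p) * (1 / w)"
      using w0 m by (simp add: z_def powr_mult powr_minus_divide)
    finally have *: "?\<mu> * \<epsilon> powr (-1 / ?\<theta>) = z powr (1 - 2 / p) * (1 / w)" .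
    have "1 \<le> z powr (1 - 2 / p)" using z False by (intro ge_one_powr_ge_zero) auto
    hence "1 * (1 / w) \<le> z powr (1 - 2 / p) * (1 / w)" using w0 by (intro mult_right_mono) auto
    thus ?thesis unfolding * by simp
  qed
  have X1: "?\<mu> * \<epsilon> powr (-1 / ?\<theta>) \<ge> 1"
  proof -
    have "1 \<le> \<epsilon> powr (-1 / ?\<theta>)" using e0 \<epsilon>(2) \<theta> powr_mono'[of "-1 / ?\<theta>" 0 \<epsilon>] by simp
    thus ?thesis using \<mu> mult_mono[of 1 ?\<mu> 1 "\<epsilon> powr (-1 / ?\<theta>)"] by simp
  qed
  have bX: "b \<ge> ?\<mu> * \<epsilon> powr (-1 / ?\<theta>)"
    unfolding bC using mult_right_mono[OF C1, of "?\<mu> * \<epsilon> powr (-1 / ?\<theta>)"] X1 by simp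
  have b1: "b \<ge> 1" using bX X1 by linarith
  have B: "real B \<ge> b" "real B \<le> 2 * b" unfolding B_def using b1 by linarith+
  have B0: "B > 0" using B(1) b1 by linarith
  have mB: "real m / real B \<le> z"
  proof -
    have "1 / w \<le> real B" using low bX B by linarith
    hence "1 \<le> real B * w" using w0 by (simp add: field_simps)
    hence "real m * 1 \<le> real m * (real B * w)" by (intro mult_left_mono) auto
    thus ?thesis using B0 by (simp add: z_def field_simps)
  qed
  have m0: "m > 0" using m by simp
  show ?thesis
  proof (rule bucket_algorithm[OF pq m0 B0 z mB])
    fix M :: "(nat \<Rightarrow> seed) measure" and A and N :: nat
    assume A: "ran_alg m M A" "ran_card m M A \<le> enat N"
      "real N \<le> 60 * real (repetitions p q) * real B * ln (ln z)"
      "ran_err p q m M A \<le> ennreal (?C * (?\<mu> / real B) powr ?\<theta>)"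
    have "?C * (?\<mu> / real B) powr ?\<theta> \<le> ?C * (?\<mu> / b) powr ?\<theta>"
      using C \<theta> \<mu> B(1) b1 by (intro mult_left_mono powr_mono2 divide_left_mono) auto
    also have "?\<mu> / b = (\<epsilon> / ?C) powr (1 / ?\<theta>)"
      using \<mu> C e0 by (simp add: b_def powr_divide)
    also have "?C * ((\<epsilon> / ?C) powr (1 / ?\<theta>)) powr ?\<theta> = \<epsilon>"
      using C e0 \<theta> by (simp add: powr_powr)
    finally have "ran_err p q m M A \<le> ennreal \<epsilon>" using A(4) by (meson ennreal_leI order_trans)
    hence "n_ran \<epsilon> p q m \<le> enat N" using n_ran_le[OF A(1)] A(2) by (meson order_trans)
    hence "ereal_of_enat (n_ran \<epsilon> p q m) \<le> ereal_of_enat (enat N)" by (simp only: ereal_of_enat_le_iff)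
    also have "\<dots> = ereal (real N)" by simp
    also have "real N \<le> 60 * real (repetitions p q) * (2 * b) * ln (ln z)"
    proof -
      have "60 * real (repetitions p q) * real B * ln (ln z) \<le> 60 * real (repetitions p q) * (2 * b) * ln (ln z)"
        using B ln_ln_ge_half[OF z] by (intro mult_right_mono mult_left_mono) auto
      thus ?thesis using A(3) by linarith
    qed
    hence "ereal (real N) \<le> ereal (60 * real (repetitions p q) * (2 * b) * ln (ln z))" by simp
    finally show ?thesis by (simp add: bC z_def w_def mult_ac)
  qed
qed

text \<open>
  With \<open>n\<close> measurements about \<open>n / (K * L)\<close> buckets are affordable, where \<open>L = ln (ln z)\<close> and
  \<open>z = m / n\<close>, but fewer buckets are larger: their mean size grows up to \<open>2 * K * L * z\<close>, and with it the cost
  per bucket. There is a \<open>K\<close> that pays for this because the growth in \<open>K\<close> is doubly logarithmic.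
\<close>
lemma loglog_budget:
  fixes R :: real
  assumes "R \<ge> 0"
  shows "\<exists>K\<ge>1. \<forall>\<Lambda> z. z \<ge> 16 \<and> \<Lambda> = ln (ln z) \<longrightarrow> 60 * R * ln (ln (2 * K * \<Lambda> * z)) \<le> K * \<Lambda>"
proof -
  (* With K = 2 * k^2, the left-hand side turns out to be at most 660 * R * k times the double
     logarithm of z, so any k above 330 * R will do. *)
  define k where "k = 330 * R + 1"
  define K where "K = 2 * k\<^sup>2"
  have k: "k \<ge> 1" using assms by (simp add: k_def)
  have "k * 1 \<le> k * k" using k by (intro mult_left_mono) auto
  hence kk: "k * k \<ge> 1" using k by linarith
  have K1: "K \<ge> 1" using kk by (simp add: K_def power2_eq_square)
  have lnK: "ln (2 * K) \<le> 4 * k"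
  proof -
    have "2 * K = (2 * k)\<^sup>2" by (simp add: K_def power2_eq_square)
    moreover have "ln ((2 * k)\<^sup>2) = real 2 * ln (2 * k)" using k by (intro ln_realpow)
    ultimately have "ln (2 * K) = 2 * ln (2 * k)" by simp
    also have "ln (2 * k) \<le> 2 * k" using k ln_bound[of "2 * k"] by simp
    finally show ?thesis by simp
  qed
  have lnK0: "ln (2 * K) \<ge> 0" using K1 by simp
  have "60 * R * ln (ln (2 * K * \<Lambda> * z)) \<le> K * \<Lambda>" if z: "z \<ge> 16" and \<Lambda>: "\<Lambda> = ln (ln z)" for \<Lambda> z :: real
  proof -
    have half: "\<Lambda> \<ge> 1 / 2" unfolding \<Lambda> by (rule ln_ln_ge_half[OF z])
    have lnz: "ln z \<ge> 1"
    proof -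
      have "ln z \<noteq> 0" using z by simp
      moreover have "ln z \<ge> 0" using z by simp
      ultimately have "ln z > 0" by linarith
      thus ?thesis using half \<Lambda> ln_ge_zero_iff[of "ln z"] by linarith
    qed
    have "\<Lambda> \<le> ln z" unfolding \<Lambda> using lnz ln_bound[of "ln z"] by simp
    also have "ln z \<le> z" using z ln_bound[of z] by simp
    finally have "ln \<Lambda> \<le> ln z" using half z by simp
    hence "ln (2 * K * \<Lambda> * z) \<le> ln (2 * K) + 2 * ln z"
      using K1 half z by (simp add: ln_mult)
    also have "\<dots> \<le> (ln (2 * K) + 2) * ln z"
      using lnK0 lnz mult_left_mono[of 1 "ln z" "ln (2 * K)"] by (simp add: distrib_right)
    finally have 1: "ln (2 * K * \<Lambda> * z) \<le> (ln (2 * K) + 2) * ln z" .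
    have 2: "ln (2 * K * \<Lambda> * z) > 0"
    proof -
      have "1 * (1 / 2) \<le> K * \<Lambda>" using K1 half by (intro mult_mono) auto
      hence "1 * 16 \<le> (2 * (K * \<Lambda>)) * z" using z by (intro mult_mono) auto
      thus ?thesis by (simp add: mult.assoc)
    qed
    have "ln (ln (2 * K * \<Lambda> * z)) \<le> ln ((ln (2 * K) + 2) * ln z)"
      using 1 2 by simp
    also have "\<dots> = ln (ln (2 * K) + 2) + \<Lambda>" using lnK0 lnz by (simp add: ln_mult \<Lambda>)
    also have "ln (ln (2 * K) + 2) \<le> ln (2 * K) + 1"
      using ln_le_minus_one[of "ln (2 * K) + 2"] lnK0 by simp
    also have "ln (2 * K) + 1 \<le> 4 * k + 1" using lnK by simp
    finally have "ln (ln (2 * K * \<Lambda> * z)) \<le> 4 * k + 1 + \<Lambda>" by simp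
    also have "\<dots> \<le> (8 * k + 3) * \<Lambda>"
      using half k mult_left_mono[of "1/2" \<Lambda> "8 * k + 2"] by (simp add: algebra_simps)
    also have "\<dots> \<le> 11 * k * \<Lambda>" using half k by (intro mult_right_mono) auto
    finally have "60 * R * ln (ln (2 * K * \<Lambda> * z)) \<le> 60 * R * (11 * k * \<Lambda>)"
      using assms by (intro mult_left_mono) auto
    also have "\<dots> = 2 * (330 * R) * k * \<Lambda>" by simp
    also have "\<dots> \<le> 2 * k * k * \<Lambda>" using half k by (intro mult_right_mono) (auto simp: k_def)
    finally show ?thesis by (simp add: K_def power2_eq_square)
  qed
  with K1 show ?thesis by blast
qed

text \<open>
  Choose \<open>B\<close> as large as the budget allows. If it does not even pay for two buckets by this count, the
  right-hand side is at least \<open>1\<close> and the zero algorithm is good enough.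
\<close>
lemma e_ran_bound:
  fixes p q :: real
  assumes pq: "1 \<le> p" "p < q"
  shows "\<exists>C>0. \<forall>m n. n \<ge> 1 \<longrightarrow> m \<ge> 16 * n \<longrightarrow>
    e_ran n p q m \<le> ennreal (C * min 1 ((noise_bound p m * ln (ln (real m / real n)) / real n) powr rate p q))"
proof -
  let ?C = "error_constant p q" and ?\<theta> = "rate p q" and ?R = "real (repetitions p q)"
  obtain K where K: "K \<ge> 1" "\<And>z. z \<ge> 16 \<Longrightarrow> 60 * ?R * ln (ln (2 * K * ln (ln z) * z)) \<le> K * ln (ln z)"
    using loglog_budget[of ?R] by auto
  have \<theta>: "?\<theta> > 0" using pq by (rule rate_pos)
  have C: "?C \<ge> 1" using pq by (intro error_constant_ge_1) simp
  define C' where "C' = ?C * (2 * K) powr ?\<theta>"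
  have K\<theta>: "(2 * K) powr ?\<theta> \<ge> 1" using K \<theta> by (intro ge_one_powr_ge_zero) auto
  have C'1: "C' \<ge> (2 * K) powr ?\<theta>"
    unfolding C'_def using mult_right_mono[OF C, of "(2 * K) powr ?\<theta>"] by simp
  have C'2: "C' \<ge> 1" using C'1 K\<theta> by linarith
  have "e_ran n p q m \<le> ennreal (C' * min 1 ((noise_bound p m * ln (ln (real m / real n)) / real n) powr ?\<theta>))"
    if n: "n \<ge> 1" and mn: "m \<ge> 16 * n" for m n :: nat
  proof -
    let ?\<mu> = "noise_bound p m"
    define z where "z = real m / real n"
    define \<Lambda> where "\<Lambda> = ln (ln z)"
    have m0: "m > 0" using n mn by simp
    have \<mu>: "?\<mu> \<ge> 1" using pq m0 by (intro noise_bound_ge_1) auto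
    have z: "z \<ge> 16" using n mn by (simp add: z_def field_simps)
    have \<Lambda>: "\<Lambda> \<ge> 1 / 2" unfolding \<Lambda>_def by (rule ln_ln_ge_half[OF z])
    have K\<Lambda>: "K * \<Lambda> \<ge> 1 / 2" using K(1) \<Lambda> mult_mono[of 1 K "1/2" \<Lambda>] by simp
    have triv: "e_ran n p q m \<le> ennreal (C' * 1)"
      using e_ran_le_1[OF pq, of n m] C'2 by (simp add: order_trans[OF _ ennreal_leI[of 1 C']])
    have "e_ran n p q m \<le> ennreal (C' * (?\<mu> * \<Lambda> / real n) powr ?\<theta>)"
    proof (cases "2 * K * \<Lambda> \<le> real n")
      case False
      hence "1 \<le> 2 * K * \<Lambda> / real n" using n by simp
      also have "\<dots> \<le> 2 * K * (?\<mu> * \<Lambda> / real n)"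
        using \<mu> K(1) \<Lambda> n mult_right_mono[of 1 ?\<mu> "2 * K * \<Lambda> / real n"] by (simp add: mult_ac)
      finally have "1 powr ?\<theta> \<le> (2 * K * (?\<mu> * \<Lambda> / real n)) powr ?\<theta>"
        using \<theta> by (intro powr_mono2) auto
      also have "\<dots> = (2 * K) powr ?\<theta> * (?\<mu> * \<Lambda> / real n) powr ?\<theta>"
        by (rule powr_mult)
      also have "\<dots> \<le> C' * (?\<mu> * \<Lambda> / real n) powr ?\<theta>" using C'1 by (intro mult_right_mono) auto
      finally have "ennreal 1 \<le> ennreal (C' * (?\<mu> * \<Lambda> / real n) powr ?\<theta>)" by (intro ennreal_leI) simp
      thus ?thesis using e_ran_le_1[OF pq, of n m] by (simp add: order_trans)
    next
      case True
      define y where "y = real n / (K * \<Lambda>)"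
      define B where "B = nat \<lfloor>y\<rfloor>"
      have y2: "y \<ge> 2" using True K\<Lambda> by (simp add: y_def pos_le_divide_eq mult.assoc)
      have B: "real B \<le> y" "y / 2 \<le> real B" unfolding B_def using y2 by linarith+
      have B0: "B > 0" using B(2) y2 by linarith
      define v where "v = real m / real B"
      have "v \<le> real m / (y / 2)" unfolding v_def using B B0 y2 by (intro divide_left_mono) auto
      also have "\<dots> = 2 * K * \<Lambda> * z" using K\<Lambda> n by (simp add: y_def z_def)
      finally have v: "v \<le> 2 * K * \<Lambda> * z" .
      show ?thesis
      proof (rule bucket_algorithm[OF pq m0 B0 _ v[unfolded v_def]])
        have "1 * 16 \<le> (2 * (K * \<Lambda>)) * z" using z K\<Lambda> by (intro mult_mono) auto
        thus "2 * K * \<Lambda> * z \<ge> 16" by (simp add: mult.assoc)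
        fix M :: "(nat \<Rightarrow> seed) measure" and A and N :: nat
        assume A: "ran_alg m M A" "ran_card m M A \<le> enat N"
          "real N \<le> 60 * ?R * real B * ln (ln (2 * K * \<Lambda> * z))"
          "ran_err p q m M A \<le> ennreal (?C * (?\<mu> / real B) powr ?\<theta>)"
        have "real N \<le> real B * (60 * ?R * ln (ln (2 * K * \<Lambda> * z)))" using A(3) by (simp add: mult_ac)
        also have "\<dots> \<le> real B * (K * \<Lambda>)"
          unfolding \<Lambda>_def by (intro mult_left_mono K(2) z) simp
        also have "\<dots> \<le> y * (K * \<Lambda>)" using B(1) K\<Lambda> by (intro mult_right_mono) auto
        also have "\<dots> = real n"
        proof -
          have "K * \<Lambda> \<noteq> 0" using K\<Lambda> by linarith
          thus ?thesis unfolding y_def by (rule nonzero_eq_divide_eq[THEN iffD1]) (rule refl)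
        qed
        finally have "N \<le> n" by simp
        hence "ran_card m M A \<le> enat n" using A(2) by (meson enat_ord_simps(1) order_trans)
        hence "e_ran n p q m \<le> ran_err p q m M A" by (rule e_ran_le[OF A(1)])
        also note A(4)
        also have "?C * (?\<mu> / real B) powr ?\<theta> \<le> ?C * (?\<mu> / (y / 2)) powr ?\<theta>"
          using C \<theta> \<mu> B y2 B0 by (intro mult_left_mono powr_mono2 divide_left_mono) auto
        also have "?\<mu> / (y / 2) = 2 * K * (?\<mu> * \<Lambda> / real n)" using K\<Lambda> n by (simp add: y_def)
        also have "?C * (2 * K * (?\<mu> * \<Lambda> / real n)) powr ?\<theta> = C' * (?\<mu> * \<Lambda> / real n) powr ?\<theta>"
          unfolding powr_mult[of "2 * K" "?\<mu> * \<Lambda> / real n"] C'_def by (rule mult.assoc[symmetric])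
        finally show ?thesis by (simp add: ennreal_leI)
      qed
    qed
    with triv show ?thesis by (simp add: min_def \<Lambda>_def z_def)
  qed
  thus ?thesis using C'2 by (intro exI[of _ C']) auto
qed

theorem theorem3p4:
  fixes p q :: real
  assumes "1 \<le> p" and "p < q"
  shows "\<exists>C>0. \<forall>m::nat. m \<ge> 16 \<longrightarrow>
    (\<forall>\<epsilon>::real. (16 / real m) powr (1/p - 1/q) \<le> \<epsilon> \<and> \<epsilon> < 1 \<longrightarrow>
       ereal_of_enat (n_ran \<epsilon> p q m) \<le> ereal (C *
         (if p \<le> 2
          then \<epsilon> powr (-1 / (1/p - 1/q)) * ln (ln (real m * \<epsilon> powr (1 / (1/p - 1/q))))
          else real m powr (1 - 2/p) * \<epsilon> powr (-2 / (1 - p/q))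
                 * ln (ln (real m * \<epsilon> powr (1 / (1/p - 1/q))))))) \<and>
    (\<forall>n::nat. n \<ge> 1 \<and> m \<ge> 16 * n \<longrightarrow>
       e_ran n p q m \<le> ennreal (C *
         (if p \<le> 2
          then min 1 ((ln (ln (real m / real n)) / real n) powr (1/p - 1/q))
          else min 1 ((real m powr (1 - 2/p) * ln (ln (real m / real n)) / real n)
                        powr (1/2 * (1 - p/q))))))"
proof -
  let ?L = "\<lambda>m \<epsilon>. ln (ln (real m * \<epsilon> powr (1 / (1/p - 1/q))))"
  let ?F = "\<lambda>m n. min 1 ((noise_bound p m * ln (ln (real m / real n)) / real n) powr rate p q)"
  obtain C2 where C2: "C2 > 0" "\<And>m n. n \<ge> 1 \<Longrightarrow> m \<ge> 16 * n \<Longrightarrow> e_ran n p q m \<le> ennreal (C2 * ?F m n)"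
    using e_ran_bound[OF assms] by blast
  define C1 where "C1 = 120 * real (repetitions p q) * error_constant p q powr (1 / rate p q)"
  have C1: "C1 \<ge> 0" by (simp add: C1_def)
  have rate1: "rate p q = 1/p - 1/q" "noise_bound p m = 1" if "p \<le> 2" for m
    using that assms by (simp_all add: rate_def noise_bound_def field_simps)
  have rate2: "rate p q = 1/2 * (1 - p/q)" "noise_bound p m = real m powr (1 - 2/p)" "-1 / rate p q = -2 / (1 - p/q)"
    if "\<not> p \<le> 2" for m
    using that assms by (simp_all add: rate_def noise_bound_def field_simps)
  have bound1: "ereal_of_enat (n_ran \<epsilon> p q m) \<le> ereal ((C1 + C2) * (noise_bound p m * \<epsilon> powr (-1 / rate p q) * ?L m \<epsilon>))"
    if m: "m \<ge> 16" and \<epsilon>: "(16 / real m) powr (1/p - 1/q) \<le> \<epsilon>" "\<epsilon> < 1" for m \<epsilon>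
  proof -
    have "real m * \<epsilon> powr (1 / (1/p - 1/q)) \<ge> 16"
      using assms m \<epsilon>(1) by (intro scaled_dimension_ge_16) auto
    from ln_ln_ge_half[OF this] have "?L m \<epsilon> \<ge> 0" by linarith
    moreover have "noise_bound p m \<ge> 0" by (simp add: noise_bound_def)
    ultimately have "C1 * (noise_bound p m * \<epsilon> powr (-1 / rate p q) * ?L m \<epsilon>)
        \<le> (C1 + C2) * (noise_bound p m * \<epsilon> powr (-1 / rate p q) * ?L m \<epsilon>)"
      using C2(1) by (intro mult_right_mono mult_nonneg_nonneg) auto
    thus ?thesis using n_ran_bound[OF assms m \<epsilon>] unfolding C1_def
      by (meson ereal_less_eq(3) order_trans)
  qed
  have bound2: "e_ran n p q m \<le> ennreal ((C1 + C2) * ?F m n)" if "n \<ge> 1" "m \<ge> 16 * n" for m n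
  proof -
    have "C2 * ?F m n \<le> (C1 + C2) * ?F m n" using C1 by (intro mult_right_mono) auto
    thus ?thesis using C2(2)[OF that] by (meson ennreal_leI order_trans)
  qed
  show ?thesis
  proof (cases "p \<le> 2")
    case True
    with bound1 bound2 C1 C2(1) show ?thesis
      by (intro exI[of _ "C1 + C2"]) (simp add: rate1)
  next
    case False
    with bound1 bound2 C1 C2(1) show ?thesis
      unfolding rate2(3)[OF False] by (intro exI[of _ "C1 + C2"]) (simp add: rate2(1,2))
  qed
qed

end
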